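(* Let $\mathbb{A}$ be a regular category and let $\mathbb{C}$ be a projective cover of $\mathbb{A}$. The following conditions are equivalent: (i) $\mathbb{A}$ is a Goursat category; (ii) $\mathbb{C}$ is a weak Goursat category; (iii) for all objects $X,U,Y,W,F,G$ of $\mathbb{C}$ and all morphisms of $\mathbb{C}$ $$\alpha:X\to U,\quad \beta:Y\to W,\quad f:X\to Y,\quad s:Y\to X,\quad g:U\to W,\quad t:W\to U,$$ $$\beta_1,\beta_2:F\to X,\quad \rho_1,\rho_2:G\to U,\quad \lambda:F\to G,$$ such that $\alpha$, $\beta$ and $\lambda$ are regular epimorphisms (in $\mathbb{C}$), $fs=1_Y$, $gt=1_W$, $g\alpha=\beta f$, $\alpha s=t\beta$, $\alpha\beta_i=\rho_i\lambda$ for $i=1,2$, and $(F,\beta_1,\beta_2)$ is a weak kernel pair of $f$ in $\mathbb{C}$, the triple $(G,\rho_1,\rho_2)$ is a weak kernel pair of $g$ in $\mathbb{C}$.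
   Context: A category with finite limits is regular if kernel pairs have coequalizers and regular epimorphisms are stable under pullback. In a regular category, a relation from $X$ to $Y$ is a subobject of $X\times Y$, and relations $R\rightarrowtail X\times Y$ and $S\rightarrowtail Y\times Z$ have a relational composite $SR\rightarrowtail X\times Z$. A relation $R$ on $X$ (that is, from $X$ to $X$) is an equivalence relation if it is reflexive ($1_X\leqslant R$), symmetric ($R^o\leqslant R$, where $R^o$ is the opposite relation) and transitive ($RR\leqslant R$). A regular category is a Goursat category if $RSR=SRS$ for any pair of equivalence relations $R$ and $S$ on the same object. An object $P$ of a category is (regular) projective if for any arrow $f:P\to X$ and any regular epimorphism $g:Y\to X$ there is an arrow $h:P\to Y$ with $gh=f$. A full subcategory $\mathbb{C}$ of $\mathbb{A}$ is a projective cover of $\mathbb{A}$ if every object of $\mathbb{C}$ is regular projective in $\mathbb{A}$ and for every object $X$ of $\mathbb{A}$ there are an object $C$ of $\mathbb{C}$ and a regular epimorphism $C\to X$ in $\mathbb{A}$. Weak limits are defined like limits, but dropping the uniqueness of the factorization. A category is weakly lex if it has weak finite limits; a projective cover of a regular category is weakly lex. A weak kernel pair of $f:X\to Y$ is a weak pullback of $f$ along itself: a pair $\beta_1,\beta_2:F\to X$ with $f\beta_1=f\beta_2$ such that any pair $a,b:Z\to X$ with $fa=fb$ is of the form $a=\beta_1c$, $b=\beta_2c$ for some (not necessarily unique) $c:Z\to F$. Let $\mathbb{C}$ be weakly lex. A pseudo-relation on an object $X$ of $\mathbb{C}$ is a pair of parallel arrows $r_1,r_2:R\to X$ in $\mathbb{C}$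 (not necessarily jointly monomorphic). It is reflexive if there is $r:X\to R$ with $r_1r=1_X=r_2r$; symmetric if there is $\sigma:R\to R$ with $r_2=r_1\sigma$ and $r_1=r_2\sigma$; transitive if, for a weak pullback $W$ with projections $p_1,p_2:W\to R$ satisfying $r_2p_1=r_1p_2$ (a weak pullback in $\mathbb{C}$ of $r_2$ along $r_1$), there is $t:W\to R$ with $r_1t=r_1p_1$ and $r_2t=r_2p_2$ (this does not depend on the choice of the weak pullback). A pseudo-equivalence relation is a pseudo-relation that is reflexive, symmetric and transitive. $\mathbb{C}$ is a weak Goursat category if, for any pseudo-equivalence relation $r_1,r_2:R\to X$ in $\mathbb{C}$ and any regular epimorphism $f:X\to Y$ in $\mathbb{C}$, the composite $fr_1,fr_2:R\to Y$ is also a pseudo-equivalence relation. Convention: when $\mathbb{C}$ is a projective cover of $\mathbb{A}$, "regular epimorphism in $\mathbb{C}$" means a morphism of $\mathbb{C}$ which is a regular epimorphism in $\mathbb{A}$ (equivalently, since objects of $\mathbb{C}$ are projective in $\mathbb{A}$, a split epimorphism in $\mathbb{C}$). *)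

theory Defs
  imports Main
begin

section \<open>Categories and full subcategories\<close>

record ('o, 'm) cat =
  Ob :: "'o set"
  Ar :: "'m set"
  Dom :: "'m \<Rightarrow> 'o"
  Cod :: "'m \<Rightarrow> 'o"
  Ide :: "'o \<Rightarrow> 'm"
  Cmp :: "'m \<Rightarrow> 'm \<Rightarrow> 'm" (infixl "\<cdot>\<index>" 70)

definition Hom :: "('o, 'm) cat \<Rightarrow> 'o \<Rightarrow> 'o \<Rightarrow> 'm set" where
  "Hom A X Y = {f \<in> Ar A. Dom A f = X \<and> Cod A f = Y}"

text \<open>In \<open>g \<cdot> f\<close> the arrow \<open>f\<close> comes first.  The values of
  \<^const>\<open>Ide\<close> and \<^const>\<open>Cmp\<close> outside objects and composable pairs are irrelevant.\<close>

locale category =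
  fixes A :: "('o, 'm) cat" (structure)
  assumes dom_in: "f \<in> Ar A \<Longrightarrow> Dom A f \<in> Ob A"
    and cod_in: "f \<in> Ar A \<Longrightarrow> Cod A f \<in> Ob A"
    and ide_hom: "X \<in> Ob A \<Longrightarrow> Ide A X \<in> Hom A X X"
    and cmp_hom: "f \<in> Hom A X Y \<Longrightarrow> g \<in> Hom A Y Z \<Longrightarrow> g \<cdot> f \<in> Hom A X Z"
    and ide_right: "f \<in> Hom A X Y \<Longrightarrow> f \<cdot> Ide A X = f"
    and ide_left: "f \<in> Hom A X Y \<Longrightarrow> Ide A Y \<cdot> f = f"
    and assoc: "f \<in> Hom A X Y \<Longrightarrow> g \<in> Hom A Y Z \<Longrightarrow> h \<in> Hom A Z V \<Longrightarrow>
      (h \<cdot> g) \<cdot> f = h \<cdot> (g \<cdot> f)"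

definition full_subcategory :: "('o, 'm) cat \<Rightarrow> ('o, 'm) cat \<Rightarrow> bool" where
  "full_subcategory C A \<longleftrightarrow> category C \<and> category A \<and> Ob C \<subseteq> Ob A \<and>
     (\<forall>X\<in>Ob C. \<forall>Y\<in>Ob C. Hom C X Y = Hom A X Y) \<and>
     (\<forall>X\<in>Ob C. Ide C X = Ide A X) \<and>
     (\<forall>X Y Z. \<forall>f\<in>Hom C X Y. \<forall>g\<in>Hom C Y Z. g \<cdot>\<^bsub>C\<^esub> f = g \<cdot>\<^bsub>A\<^esub> f)"

section \<open>Limits and weak limits\<close>

definition is_functor ::
  "('i, 'j) cat \<Rightarrow> ('o, 'm) cat \<Rightarrow> ('i \<Rightarrow> 'o) \<Rightarrow> ('j \<Rightarrow> 'm) \<Rightarrow> bool" where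
  "is_functor J A D\<^sub>o D \<longleftrightarrow> category J \<and> category A \<and>
     (\<forall>i\<in>Ob J. D\<^sub>o i \<in> Ob A) \<and>
     (\<forall>i j. \<forall>u\<in>Hom J i j. D u \<in> Hom A (D\<^sub>o i) (D\<^sub>o j)) \<and>
     (\<forall>i\<in>Ob J. D (Ide J i) = Ide A (D\<^sub>o i)) \<and>
     (\<forall>i j k. \<forall>u\<in>Hom J i j. \<forall>v\<in>Hom J j k. D (v \<cdot>\<^bsub>J\<^esub> u) = D v \<cdot>\<^bsub>A\<^esub> D u)"

definition cone ::
  "('i, 'j) cat \<Rightarrow> ('o, 'm) cat \<Rightarrow> ('i \<Rightarrow> 'o) \<Rightarrow> ('j \<Rightarrow> 'm) \<Rightarrow> 'o \<Rightarrow> ('i \<Rightarrow> 'm) \<Rightarrow> bool" where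
  "cone J A D\<^sub>o D L \<pi> \<longleftrightarrow> L \<in> Ob A \<and> (\<forall>i\<in>Ob J. \<pi> i \<in> Hom A L (D\<^sub>o i)) \<and>
     (\<forall>i j. \<forall>u\<in>Hom J i j. D u \<cdot>\<^bsub>A\<^esub> \<pi> i = \<pi> j)"

definition limit ::
  "('i, 'j) cat \<Rightarrow> ('o, 'm) cat \<Rightarrow> ('i \<Rightarrow> 'o) \<Rightarrow> ('j \<Rightarrow> 'm) \<Rightarrow> 'o \<Rightarrow> ('i \<Rightarrow> 'm) \<Rightarrow> bool" where
  "limit J A D\<^sub>o D L \<pi> \<longleftrightarrow> cone J A D\<^sub>o D L \<pi> \<and>
     (\<forall>M \<mu>. cone J A D\<^sub>o D M \<mu> \<longrightarrow>
        (\<exists>!h. h \<in> Hom A M L \<and> (\<forall>i\<in>Ob J. \<pi> i \<cdot>\<^bsub>A\<^esub> h = \<mu> i)))"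

definition weak_limit ::
  "('i, 'j) cat \<Rightarrow> ('o, 'm) cat \<Rightarrow> ('i \<Rightarrow> 'o) \<Rightarrow> ('j \<Rightarrow> 'm) \<Rightarrow> 'o \<Rightarrow> ('i \<Rightarrow> 'm) \<Rightarrow> bool" where
  "weak_limit J A D\<^sub>o D L \<pi> \<longleftrightarrow> cone J A D\<^sub>o D L \<pi> \<and>
     (\<forall>M \<mu>. cone J A D\<^sub>o D M \<mu> \<longrightarrow>
        (\<exists>h. h \<in> Hom A M L \<and> (\<forall>i\<in>Ob J. \<pi> i \<cdot>\<^bsub>A\<^esub> h = \<mu> i)))"

text \<open>Every finite category is isomorphic to one whose objects and arrows are natural numbers,
  so it is enough to let finite shapes range over such categories.\<close>

definition has_finite_limits :: "('o, 'm) cat \<Rightarrow> bool" where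
  "has_finite_limits A \<longleftrightarrow>
     (\<forall>(J :: (nat, nat) cat) D\<^sub>o D. finite (Ob J) \<and> finite (Ar J) \<and> is_functor J A D\<^sub>o D \<longrightarrow>
        (\<exists>L \<pi>. limit J A D\<^sub>o D L \<pi>))"

definition weakly_lex :: "('o, 'm) cat \<Rightarrow> bool" where
  "weakly_lex A \<longleftrightarrow> category A \<and>
     (\<forall>(J :: (nat, nat) cat) D\<^sub>o D. finite (Ob J) \<and> finite (Ar J) \<and> is_functor J A D\<^sub>o D \<longrightarrow>
        (\<exists>L \<pi>. weak_limit J A D\<^sub>o D L \<pi>))"

definition is_product ::
  "('o, 'm) cat \<Rightarrow> 'o \<Rightarrow> 'o \<Rightarrow> 'o \<Rightarrow> 'm \<Rightarrow> 'm \<Rightarrow> bool" where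
  "is_product A X Y P p q \<longleftrightarrow> p \<in> Hom A P X \<and> q \<in> Hom A P Y \<and>
     (\<forall>Z. \<forall>a\<in>Hom A Z X. \<forall>b\<in>Hom A Z Y.
        \<exists>!c. c \<in> Hom A Z P \<and> p \<cdot>\<^bsub>A\<^esub> c = a \<and> q \<cdot>\<^bsub>A\<^esub> c = b)"

definition pullback :: "('o, 'm) cat \<Rightarrow> 'm \<Rightarrow> 'm \<Rightarrow> 'o \<Rightarrow> 'm \<Rightarrow> 'm \<Rightarrow> bool" where
  "pullback A f g P p q \<longleftrightarrow>
     (\<exists>X Y V. f \<in> Hom A X V \<and> g \<in> Hom A Y V \<and> p \<in> Hom A P X \<and> q \<in> Hom A P Y \<and>
        f \<cdot>\<^bsub>A\<^esub> p = g \<cdot>\<^bsub>A\<^esub> q \<and>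
        (\<forall>Z. \<forall>a\<in>Hom A Z X. \<forall>b\<in>Hom A Z Y. f \<cdot>\<^bsub>A\<^esub> a = g \<cdot>\<^bsub>A\<^esub> b \<longrightarrow>
           (\<exists>!c. c \<in> Hom A Z P \<and> p \<cdot>\<^bsub>A\<^esub> c = a \<and> q \<cdot>\<^bsub>A\<^esub> c = b)))"

definition weak_pullback :: "('o, 'm) cat \<Rightarrow> 'm \<Rightarrow> 'm \<Rightarrow> 'o \<Rightarrow> 'm \<Rightarrow> 'm \<Rightarrow> bool" where
  "weak_pullback A f g P p q \<longleftrightarrow>
     (\<exists>X Y V. f \<in> Hom A X V \<and> g \<in> Hom A Y V \<and> p \<in> Hom A P X \<and> q \<in> Hom A P Y \<and>
        f \<cdot>\<^bsub>A\<^esub> p = g \<cdot>\<^bsub>A\<^esub> q \<and>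
        (\<forall>Z. \<forall>a\<in>Hom A Z X. \<forall>b\<in>Hom A Z Y. f \<cdot>\<^bsub>A\<^esub> a = g \<cdot>\<^bsub>A\<^esub> b \<longrightarrow>
           (\<exists>c. c \<in> Hom A Z P \<and> p \<cdot>\<^bsub>A\<^esub> c = a \<and> q \<cdot>\<^bsub>A\<^esub> c = b)))"

definition kernel_pair :: "('o, 'm) cat \<Rightarrow> 'm \<Rightarrow> 'o \<Rightarrow> 'm \<Rightarrow> 'm \<Rightarrow> bool" where
  "kernel_pair A f P p q \<longleftrightarrow> pullback A f f P p q"

definition weak_kernel_pair :: "('o, 'm) cat \<Rightarrow> 'm \<Rightarrow> 'o \<Rightarrow> 'm \<Rightarrow> 'm \<Rightarrow> bool" where
  "weak_kernel_pair A f P p q \<longleftrightarrow> weak_pullback A f f P p q"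

section \<open>Regular categories and projective covers\<close>

definition monomorphism :: "('o, 'm) cat \<Rightarrow> 'm \<Rightarrow> bool" where
  "monomorphism A m \<longleftrightarrow> m \<in> Ar A \<and>
     (\<forall>Z. \<forall>a\<in>Hom A Z (Dom A m). \<forall>b\<in>Hom A Z (Dom A m). m \<cdot>\<^bsub>A\<^esub> a = m \<cdot>\<^bsub>A\<^esub> b \<longrightarrow> a = b)"

definition coequalizer :: "('o, 'm) cat \<Rightarrow> 'm \<Rightarrow> 'm \<Rightarrow> 'm \<Rightarrow> bool" where
  "coequalizer A u v q \<longleftrightarrow>
     (\<exists>Z Y Q. u \<in> Hom A Z Y \<and> v \<in> Hom A Z Y \<and> q \<in> Hom A Y Q \<and> q \<cdot>\<^bsub>A\<^esub> u = q \<cdot>\<^bsub>A\<^esub> v \<and>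
        (\<forall>T. \<forall>t\<in>Hom A Y T. t \<cdot>\<^bsub>A\<^esub> u = t \<cdot>\<^bsub>A\<^esub> v \<longrightarrow>
           (\<exists>!h. h \<in> Hom A Q T \<and> h \<cdot>\<^bsub>A\<^esub> q = t)))"

definition regular_epi :: "('o, 'm) cat \<Rightarrow> 'm \<Rightarrow> bool" where
  "regular_epi A q \<longleftrightarrow> (\<exists>u v. coequalizer A u v q)"

definition regular_category :: "('o, 'm) cat \<Rightarrow> bool" where
  "regular_category A \<longleftrightarrow> category A \<and> has_finite_limits A \<and>
     (\<forall>f P p q. kernel_pair A f P p q \<longrightarrow> (\<exists>e. coequalizer A p q e)) \<and>
     (\<forall>f g P p q. pullback A f g P p q \<and> regular_epi A g \<longrightarrow> regular_epi A p)"

definition regular_projective :: "('o, 'm) cat \<Rightarrow> 'o \<Rightarrow> bool" where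
  "regular_projective A P \<longleftrightarrow> P \<in> Ob A \<and>
     (\<forall>X Y. \<forall>f\<in>Hom A P X. \<forall>g\<in>Hom A Y X. regular_epi A g \<longrightarrow>
        (\<exists>h\<in>Hom A P Y. g \<cdot>\<^bsub>A\<^esub> h = f))"

definition projective_cover :: "('o, 'm) cat \<Rightarrow> ('o, 'm) cat \<Rightarrow> bool" where
  "projective_cover C A \<longleftrightarrow> full_subcategory C A \<and>
     (\<forall>P\<in>Ob C. regular_projective A P) \<and>
     (\<forall>X\<in>Ob A. \<exists>P\<in>Ob C. \<exists>e\<in>Hom A P X. regular_epi A e)"

section \<open>Relations and Goursat categories\<close>

text \<open>A subobject \<open>m : R \<rightarrowtail> X \<times> Y\<close> is represented by the pair of its components
  \<open>(p \<cdot> m, q \<cdot> m)\<close>, where \<open>p\<close> and \<open>q\<close> are the product projections; this pair determines \<open>m\<close>.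
  Factorizations between such pairs are the same as factorizations between the monomorphisms, so
  \<open>rel_le\<close> is the order of subobjects and \<open>rel_eq\<close> is equality of subobjects.\<close>

definition relation :: "('o, 'm) cat \<Rightarrow> 'o \<Rightarrow> 'o \<Rightarrow> 'm \<times> 'm \<Rightarrow> bool" where
  "relation A X Y R \<longleftrightarrow>
     (\<exists>P p q m. is_product A X Y P p q \<and> monomorphism A m \<and> Cod A m = P \<and>
        R = (p \<cdot>\<^bsub>A\<^esub> m, q \<cdot>\<^bsub>A\<^esub> m))"

definition rel_le :: "('o, 'm) cat \<Rightarrow> 'm \<times> 'm \<Rightarrow> 'm \<times> 'm \<Rightarrow> bool" where
  "rel_le A R S \<longleftrightarrow>
     (\<exists>h\<in>Hom A (Dom A (fst R)) (Dom A (fst S)). fst S \<cdot>\<^bsub>A\<^esub> h = fst R \<and> snd S \<cdot>\<^bsub>A\<^esub> h = snd R)"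

definition rel_eq :: "('o, 'm) cat \<Rightarrow> 'm \<times> 'm \<Rightarrow> 'm \<times> 'm \<Rightarrow> bool" where
  "rel_eq A R S \<longleftrightarrow> rel_le A R S \<and> rel_le A S R"

text \<open>\<open>rel_comp A S R T\<close> says that \<open>T\<close> is the relational composite \<open>S R\<close> (first \<open>R\<close>, then \<open>S\<close>): the
  regular image of the pullback \<open>R \<times>\<^sub>Y S\<close> in \<open>X \<times> Z\<close>.  In a regular category the composite exists
  and is determined up to \<^const>\<open>rel_eq\<close>.\<close>

definition rel_comp :: "('o, 'm) cat \<Rightarrow> 'm \<times> 'm \<Rightarrow> 'm \<times> 'm \<Rightarrow> 'm \<times> 'm \<Rightarrow> bool" where
  "rel_comp A S R T \<longleftrightarrow>
     (\<exists>X Y Z W p q e. relation A X Y R \<and> relation A Y Z S \<and> relation A X Z T \<and>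
        pullback A (snd R) (fst S) W p q \<and>
        e \<in> Hom A W (Dom A (fst T)) \<and> regular_epi A e \<and>
        fst T \<cdot>\<^bsub>A\<^esub> e = fst R \<cdot>\<^bsub>A\<^esub> p \<and> snd T \<cdot>\<^bsub>A\<^esub> e = snd S \<cdot>\<^bsub>A\<^esub> q)"

definition rel_comp3 ::
  "('o, 'm) cat \<Rightarrow> 'm \<times> 'm \<Rightarrow> 'm \<times> 'm \<Rightarrow> 'm \<times> 'm \<Rightarrow> 'm \<times> 'm \<Rightarrow> bool" where
  "rel_comp3 A Q S R T \<longleftrightarrow> (\<exists>U. rel_comp A S R U \<and> rel_comp A Q U T)"

definition equivalence_relation :: "('o, 'm) cat \<Rightarrow> 'o \<Rightarrow> 'm \<times> 'm \<Rightarrow> bool" where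
  "equivalence_relation A X R \<longleftrightarrow> relation A X X R \<and>
     rel_le A (Ide A X, Ide A X) R \<and>
     rel_le A (snd R, fst R) R \<and>
     (\<exists>T. rel_comp A R R T \<and> rel_le A T R)"

definition goursat :: "('o, 'm) cat \<Rightarrow> bool" where
  "goursat A \<longleftrightarrow> regular_category A \<and>
     (\<forall>X R S. equivalence_relation A X R \<and> equivalence_relation A X S \<longrightarrow>
        (\<exists>T T'. rel_comp3 A R S R T \<and> rel_comp3 A S R S T' \<and> rel_eq A T T'))"

section \<open>Pseudo-relations and weak Goursat categories\<close>

definition pseudo_relation :: "('o, 'm) cat \<Rightarrow> 'o \<Rightarrow> 'o \<Rightarrow> 'm \<Rightarrow> 'm \<Rightarrow> bool" where
  "pseudo_relation C X R r\<^sub>1 r\<^sub>2 \<longleftrightarrow> r\<^sub>1 \<in> Hom C R X \<and> r\<^sub>2 \<in> Hom C R X"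

definition pseudo_reflexive :: "('o, 'm) cat \<Rightarrow> 'o \<Rightarrow> 'o \<Rightarrow> 'm \<Rightarrow> 'm \<Rightarrow> bool" where
  "pseudo_reflexive C X R r\<^sub>1 r\<^sub>2 \<longleftrightarrow>
     (\<exists>r\<in>Hom C X R. r\<^sub>1 \<cdot>\<^bsub>C\<^esub> r = Ide C X \<and> r\<^sub>2 \<cdot>\<^bsub>C\<^esub> r = Ide C X)"

definition pseudo_symmetric :: "('o, 'm) cat \<Rightarrow> 'o \<Rightarrow> 'o \<Rightarrow> 'm \<Rightarrow> 'm \<Rightarrow> bool" where
  "pseudo_symmetric C X R r\<^sub>1 r\<^sub>2 \<longleftrightarrow>
     (\<exists>\<sigma>\<in>Hom C R R. r\<^sub>2 = r\<^sub>1 \<cdot>\<^bsub>C\<^esub> \<sigma> \<and> r\<^sub>1 = r\<^sub>2 \<cdot>\<^bsub>C\<^esub> \<sigma>)"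

definition pseudo_transitive :: "('o, 'm) cat \<Rightarrow> 'o \<Rightarrow> 'o \<Rightarrow> 'm \<Rightarrow> 'm \<Rightarrow> bool" where
  "pseudo_transitive C X R r\<^sub>1 r\<^sub>2 \<longleftrightarrow>
     (\<exists>W p\<^sub>1 p\<^sub>2. weak_pullback C r\<^sub>2 r\<^sub>1 W p\<^sub>1 p\<^sub>2 \<and>
        (\<exists>t\<in>Hom C W R. r\<^sub>1 \<cdot>\<^bsub>C\<^esub> t = r\<^sub>1 \<cdot>\<^bsub>C\<^esub> p\<^sub>1 \<and> r\<^sub>2 \<cdot>\<^bsub>C\<^esub> t = r\<^sub>2 \<cdot>\<^bsub>C\<^esub> p\<^sub>2))"

definition pseudo_equivalence_relation ::
  "('o, 'm) cat \<Rightarrow> 'o \<Rightarrow> 'o \<Rightarrow> 'm \<Rightarrow> 'm \<Rightarrow> bool" where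
  "pseudo_equivalence_relation C X R r\<^sub>1 r\<^sub>2 \<longleftrightarrow> pseudo_relation C X R r\<^sub>1 r\<^sub>2 \<and>
     pseudo_reflexive C X R r\<^sub>1 r\<^sub>2 \<and> pseudo_symmetric C X R r\<^sub>1 r\<^sub>2 \<and> pseudo_transitive C X R r\<^sub>1 r\<^sub>2"

text \<open>For a projective cover \<open>C\<close> of \<open>A\<close>, a regular epimorphism in \<open>C\<close> is by convention an arrow of \<open>C\<close>
  that is a regular epimorphism in \<open>A\<close>; hence the dependence on \<open>A\<close> below.\<close>

definition cover_regular_epi :: "('o, 'm) cat \<Rightarrow> ('o, 'm) cat \<Rightarrow> 'm \<Rightarrow> bool" where
  "cover_regular_epi C A f \<longleftrightarrow> f \<in> Ar C \<and> regular_epi A f"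

definition weak_goursat :: "('o, 'm) cat \<Rightarrow> ('o, 'm) cat \<Rightarrow> bool" where
  "weak_goursat C A \<longleftrightarrow> weakly_lex C \<and>
     (\<forall>X R r\<^sub>1 r\<^sub>2 Y f. pseudo_equivalence_relation C X R r\<^sub>1 r\<^sub>2 \<and>
        f \<in> Hom C X Y \<and> cover_regular_epi C A f \<longrightarrow>
        pseudo_equivalence_relation C Y R (f \<cdot>\<^bsub>C\<^esub> r\<^sub>1) (f \<cdot>\<^bsub>C\<^esub> r\<^sub>2))"

end

theory Submission
  imports Defs
begin

text \<open>Every object of \<open>C\<close> is projective and every object of \<open>A\<close> is covered by one, so a relation in \<open>A\<close>,
  or a pseudo-relation in \<open>C\<close>, can be replaced by the family of set-theoretic relations that it induces
  on \<open>Hom A P X\<close> for \<open>P\<close> in \<open>C\<close>.  Regular images do not change this family, inclusion and composition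
  are computed pointwise, and the (pseudo-)equivalence relations are those whose members are
  equivalence relations.  Thus \<open>C\<close> is weak Goursat iff images of equivalence relations along regular
  epimorphisms are transitive; when \<open>R K R = K R K\<close> for the kernel pair \<open>K\<close> of \<open>f\<close>, this holds for the
  image of \<open>R\<close> along \<open>f\<close>.  Conversely \<open>S R S\<close> is such an image, so it is transitive and contains
  \<open>R S R\<close>.  For the kernel pair condition, if \<open>g u = g v\<close> then \<open>u\<close> and \<open>v\<close> are both related to
  \<open>t g u = t g v\<close> in the image of the kernel pair of \<open>f\<close>.\<close>

section \<open>Categories\<close>

context category
begin

text \<open>Test objects are restricted to \<open>C\<close> because a point of a regular image lifts
  to the covering object when it is defined on a projective object; on other objects a composite may
  have points that are not composites of points. That nothing is lost is a descent argument: an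
  inclusion of families gives a factorization over a cover, which passes to the covered object
  because the larger relation is jointly monic. Points forget how often a pair is attained, so they
  see a pseudo-relation only through its image; being a pseudo-equivalence relation or a weak kernel
  pair depends on that image alone. Relations of \<open>A\<close> and products such as Y \<times> Y
  need not lie in \<open>C\<close>; where an object of \<open>C\<close> is required, a cover takes
  their place, at the cost of uniqueness and joint monicity.\<close>

lemma hom_ob:
  assumes "f \<in> Hom A X Y"
  shows "X \<in> Ob A" "Y \<in> Ob A"
  using assms dom_in cod_in by (auto simp: Hom_def)

text \<open>Associativity has the types of the three arrows as premises, so it is not a plain
  rewrite rule. This form precomposes a commuting square with \<open>h\<close> in one step;
  \<open>cmp_eq_extend1\<close> is the form for a triangle.\<close>

lemma cmp_eq_extend:
  assumes "f \<cdot> p = g \<cdot> q" "p \<in> Hom A P X" "f \<in> Hom A X V" "q \<in> Hom A P Y" "g \<in> Hom A Y V"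
    "h \<in> Hom A Z P"
  shows "f \<cdot> (p \<cdot> h) = g \<cdot> (q \<cdot> h)"
  using assms assoc[of h Z P p X f V] assoc[of h Z P q Y g V] by simp

lemma cmp_eq_extend1:
  assumes "f \<cdot> p = k" "p \<in> Hom A P X" "f \<in> Hom A X V" "h \<in> Hom A Z P"
  shows "f \<cdot> (p \<cdot> h) = k \<cdot> h"
  using assms assoc[of h Z P p X f V] by simp

text \<open>\<open>pullback\<close> hides the three objects under an existential quantifier. Since
  \<open>Dom\<close> and \<open>Cod\<close> are functions, the types of \<open>f\<close> and
  \<open>g\<close> force the witnesses to be the given objects.\<close>

lemma pullbackE:
  assumes "pullback A f g P p q" "f \<in> Hom A X V" "g \<in> Hom A Y V"
  shows "p \<in> Hom A P X" "q \<in> Hom A P Y" "f \<cdot> p = g \<cdot> q"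
    "\<And>Z a b. a \<in> Hom A Z X \<Longrightarrow> b \<in> Hom A Z Y \<Longrightarrow> f \<cdot> a = g \<cdot> b \<Longrightarrow>
       \<exists>!c. c \<in> Hom A Z P \<and> p \<cdot> c = a \<and> q \<cdot> c = b"
  using assms unfolding pullback_def by (auto simp: Hom_def)

lemma epi_cancel:
  assumes "regular_epi A e" "e \<in> Hom A X Y" "a \<in> Hom A Y Z" "b \<in> Hom A Y Z" "a \<cdot> e = b \<cdot> e"
  shows "a = b"
proof -
  obtain u v W Y' Q where c: "u \<in> Hom A W Y'" "v \<in> Hom A W Y'" "e \<in> Hom A Y' Q" "e \<cdot> u = e \<cdot> v"
    and U: "\<And>T t. t \<in> Hom A Y' T \<Longrightarrow> t \<cdot> u = t \<cdot> v \<Longrightarrow> \<exists>!h. h \<in> Hom A Q T \<and> h \<cdot> e = t"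
    using assms(1) unfolding regular_epi_def coequalizer_def by blast
  have eq: "Y' = X" "Q = Y" using c(3) assms(2) by (auto simp: Hom_def)
  have "(a \<cdot> e) \<cdot> u = (a \<cdot> e) \<cdot> v"
    using c eq assoc[of u W X e Y a Z] assoc[of v W X e Y a Z] assms(3) by simp
  then show ?thesis using U[of "a \<cdot> e" Z] assms cmp_hom eq by metis
qed

text \<open>\<open>e\<close> is the coequalizer of a pair that is not known. \<open>compat\<close>
  covers every pair with equal composites with \<open>e\<close>, hence that one.\<close>

lemma regular_epi_factor:
  assumes "regular_epi A e" "e \<in> Hom A X Y" "t \<in> Hom A X T"
    and compat: "\<And>W u v. u \<in> Hom A W X \<Longrightarrow> v \<in> Hom A W X \<Longrightarrow> e \<cdot> u = e \<cdot> v \<Longrightarrow> t \<cdot> u = t \<cdot> v"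
  shows "\<exists>h\<in>Hom A Y T. h \<cdot> e = t"
proof -
  obtain u v W Y' Q where c: "u \<in> Hom A W Y'" "v \<in> Hom A W Y'" "e \<in> Hom A Y' Q" "e \<cdot> u = e \<cdot> v"
    and U: "\<And>T t. t \<in> Hom A Y' T \<Longrightarrow> t \<cdot> u = t \<cdot> v \<Longrightarrow> \<exists>!h. h \<in> Hom A Q T \<and> h \<cdot> e = t"
    using assms(1) unfolding regular_epi_def coequalizer_def by blast
  have eq: "Y' = X" "Q = Y" using c(3) assms(2) by (auto simp: Hom_def)
  show ?thesis using U[of t T] compat[of u W v] c assms(3) eq by metis
qed

text \<open>\<open>e\<close> is the coequalizer of the idempotent \<open>k \<cdot> e\<close> and the
  identity: an arrow \<open>t\<close> that does not distinguish these two factors through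
  \<open>e\<close> as \<open>t \<cdot> k\<close>.\<close>

lemma split_epi_regular:
  assumes "e \<in> Hom A X Y" "k \<in> Hom A Y X" "e \<cdot> k = Ide A Y"
  shows "regular_epi A e"
proof -
  have k: "k \<cdot> e \<in> Hom A X X" and i: "Ide A X \<in> Hom A X X"
    using assms cmp_hom ide_hom hom_ob by blast+
  have 1: "e \<cdot> (k \<cdot> e) = e \<cdot> Ide A X"
    using assms assoc[of e X Y k X e Y] ide_left[of e X Y] ide_right[of e X Y] by auto
  have 2: "\<exists>!h. h \<in> Hom A Y T \<and> h \<cdot> e = t"
    if t: "t \<in> Hom A X T" "t \<cdot> (k \<cdot> e) = t \<cdot> Ide A X" for T t
  proof (rule ex1I[of _ "t \<cdot> k"])
    show "t \<cdot> k \<in> Hom A Y T \<and> (t \<cdot> k) \<cdot> e = t"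
      using t assms cmp_hom[of k Y X t T] assoc[of e X Y k X t T] ide_right[of t X T] by simp
  next
    fix h assume h: "h \<in> Hom A Y T \<and> h \<cdot> e = t"
    have "t \<cdot> k = h \<cdot> (e \<cdot> k)" using assoc[of k Y X e Y h T] h assms(1,2) by simp
    then show "h = t \<cdot> k" using h assms(3) ide_right[of h Y T] by simp
  qed
  have "coequalizer A (k \<cdot> e) (Ide A X) e"
    unfolding coequalizer_def using k i assms(1) 1 2 by blast
  then show ?thesis unfolding regular_epi_def by blast
qed

end

section \<open>Pullbacks and products from finite limits\<close>

definition discrete_pair :: "(nat, nat) cat" where
  "discrete_pair = \<lparr>Ob = {0, 1}, Ar = {0, 1}, Dom = (\<lambda>u. u), Cod = (\<lambda>u. u), Ide = (\<lambda>i. i),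
     Cmp = (\<lambda>v u. u)\<rparr>"

text \<open>The arrows \<open>0, 1, 2\<close> are the identities, \<open>3 : 0 \<rightarrow> 2\<close> and \<open>4 : 1 \<rightarrow> 2\<close>.\<close>

definition cospan :: "(nat, nat) cat" where
  "cospan = \<lparr>Ob = {0, 1, 2}, Ar = {0, 1, 2, 3, 4}, Dom = (\<lambda>u. if u = 3 then 0 else if u = 4 then 1 else u),
     Cod = (\<lambda>u. if u \<ge> 2 then 2 else u), Ide = (\<lambda>i. i), Cmp = (\<lambda>v u. if u < 3 then v else u)\<rparr>"

lemma discrete_pair_simps:
  "Ob discrete_pair = {0, 1}" "Ide discrete_pair i = i" "v \<cdot>\<^bsub>discrete_pair\<^esub> u = u"
  "u \<in> Hom discrete_pair i j \<longleftrightarrow> u = i \<and> j = i \<and> i \<in> {0, 1}"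
  by (auto simp: discrete_pair_def Hom_def)

lemma cospan_ops_simps:
  "Ob cospan = {0, 1, 2}" "Ide cospan i = i" "v \<cdot>\<^bsub>cospan\<^esub> u = (if u < 3 then v else u)"
  by (auto simp: cospan_def)

lemma cospan_Hom_iff:
  "u \<in> Hom cospan i j \<longleftrightarrow>
     i \<in> {0, 1, 2} \<and> j = i \<and> u = i \<or> i = 0 \<and> j = 2 \<and> u = 3 \<or> i = 1 \<and> j = 2 \<and> u = 4"
  by (simp add: cospan_def Hom_def) presburger

lemmas cospan_simps = cospan_ops_simps cospan_Hom_iff

lemma category_discrete_pair: "category discrete_pair"
  by unfold_locales (simp_all add: discrete_pair_simps, auto simp: discrete_pair_def)

lemma category_cospan: "category cospan"
  by unfold_locales (simp_all only: cospan_simps, auto simp: cospan_def)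

context category
begin

lemma ex_product:
  assumes "has_finite_limits A" "X \<in> Ob A" "Y \<in> Ob A"
  shows "\<exists>P p q. is_product A X Y P p q"
proof -
  define O\<^sub>X\<^sub>Y where "O\<^sub>X\<^sub>Y = (\<lambda>i::nat. if i = 0 then X else Y)"
  define D where "D = (\<lambda>i. Ide A (O\<^sub>X\<^sub>Y i))"
  have ob: "O\<^sub>X\<^sub>Y i \<in> Ob A" for i using assms by (simp add: O\<^sub>X\<^sub>Y_def)
  have "is_functor discrete_pair A O\<^sub>X\<^sub>Y D"
    unfolding is_functor_def using category_discrete_pair category_axioms ob ide_hom ide_left[OF ide_hom[OF ob]]
    by (auto simp: D_def discrete_pair_simps)
  moreover have "finite (Ob discrete_pair)" "finite (Ar discrete_pair)"
    by (auto simp: discrete_pair_def)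
  ultimately obtain L \<pi> where L: "limit discrete_pair A O\<^sub>X\<^sub>Y D L \<pi>"
    using assms(1) unfolding has_finite_limits_def by blast
  have cone_iff: "cone discrete_pair A O\<^sub>X\<^sub>Y D M \<mu> \<longleftrightarrow> \<mu> 0 \<in> Hom A M X \<and> \<mu> 1 \<in> Hom A M Y" for M \<mu>
    unfolding cone_def using ide_left hom_ob
    by (auto simp: discrete_pair_simps D_def O\<^sub>X\<^sub>Y_def)
  have "is_product A X Y L (\<pi> 0) (\<pi> 1)"
    unfolding is_product_def
  proof (intro conjI allI ballI)
    show "\<pi> 0 \<in> Hom A L X" "\<pi> 1 \<in> Hom A L Y" using L cone_iff unfolding limit_def by auto
    fix Z a b assume "a \<in> Hom A Z X" "b \<in> Hom A Z Y"
    then have "cone discrete_pair A O\<^sub>X\<^sub>Y D Z (\<lambda>i. if i = 0 then a else b)" by (simp add: cone_iff)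
    then have "\<exists>!h. h \<in> Hom A Z L \<and> (\<forall>i\<in>Ob discrete_pair. \<pi> i \<cdot> h = (if i = 0 then a else b))"
      using L unfolding limit_def by blast
    then show "\<exists>!c. c \<in> Hom A Z L \<and> \<pi> 0 \<cdot> c = a \<and> \<pi> 1 \<cdot> c = b"
      by (simp add: discrete_pair_simps)
  qed
  then show ?thesis by blast
qed

lemma ex_pullback:
  assumes "has_finite_limits A" and f: "f \<in> Hom A X V" and g: "g \<in> Hom A Y V"
  shows "\<exists>P p q. pullback A f g P p q"
proof -
  define O\<^sub>D where "O\<^sub>D = (\<lambda>i::nat. if i = 0 then X else if i = 1 then Y else V)"
  define D where "D = (\<lambda>u::nat. if u < 3 then Ide A (O\<^sub>D u) else if u = 3 then f else g)"
  have ob: "O\<^sub>D i \<in> Ob A" for i using hom_ob[OF f] hom_ob[OF g] by (simp add: O\<^sub>D_def)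
  have "is_functor cospan A O\<^sub>D D"
    unfolding is_functor_def
  proof (intro conjI allI ballI)
    show "category cospan" "category A" by (rule category_cospan, rule category_axioms)
    show "O\<^sub>D i \<in> Ob A" for i by (rule ob)
    show "D u \<in> Hom A (O\<^sub>D i) (O\<^sub>D j)" if "u \<in> Hom cospan i j" for i j u
      using that f g ide_hom hom_ob[OF f] hom_ob[OF g] by (auto simp: cospan_simps D_def O\<^sub>D_def)
    show "D (Ide cospan i) = Ide A (O\<^sub>D i)" if "i \<in> Ob cospan" for i
      using that by (auto simp: cospan_simps D_def O\<^sub>D_def)
    show "D (v \<cdot>\<^bsub>cospan\<^esub> u) = D v \<cdot> D u" if "u \<in> Hom cospan i j" "v \<in> Hom cospan j k" for i j k u v
      using that ide_right[OF f] ide_left[OF f] ide_right[OF g] ide_left[OF g]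
        ide_left[OF ide_hom] hom_ob[OF f] hom_ob[OF g]
      by (auto simp: cospan_simps D_def O\<^sub>D_def split: if_splits)
  qed
  moreover have "finite (Ob cospan)" "finite (Ar cospan)" by (auto simp: cospan_def)
  ultimately obtain L \<pi> where L: "limit cospan A O\<^sub>D D L \<pi>"
    using assms(1) unfolding has_finite_limits_def by blast
  have cone_iff: "cone cospan A O\<^sub>D D M \<mu> \<longleftrightarrow> \<mu> 0 \<in> Hom A M X \<and> \<mu> 1 \<in> Hom A M Y \<and> \<mu> 2 \<in> Hom A M V \<and>
      f \<cdot> \<mu> 0 = \<mu> 2 \<and> g \<cdot> \<mu> 1 = \<mu> 2" (is "?l \<longleftrightarrow> ?r") for M \<mu>
  proof
    assume l: ?l
    have "3 \<in> Hom cospan 0 2" "4 \<in> Hom cospan 1 2" by (auto simp: cospan_simps)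
    then have "D 3 \<cdot> \<mu> 0 = \<mu> 2" "D 4 \<cdot> \<mu> 1 = \<mu> 2" using l unfolding cone_def by blast+
    moreover have "\<mu> i \<in> Hom A M (O\<^sub>D i)" if "i \<in> {0,1,2}" for i
      using l that unfolding cone_def cospan_simps by auto
    from this[of 0] this[of 1] this[of 2]
    have "\<mu> 0 \<in> Hom A M X" "\<mu> 1 \<in> Hom A M Y" "\<mu> 2 \<in> Hom A M V" by (auto simp: O\<^sub>D_def)
    ultimately show ?r by (simp add: D_def)
  next
    assume r: ?r
    show ?l
      unfolding cone_def
    proof (intro conjI allI ballI)
      show "M \<in> Ob A" using r hom_ob by blast
      show "\<mu> i \<in> Hom A M (O\<^sub>D i)" if "i \<in> Ob cospan" for i
        using that r by (auto simp: cospan_simps O\<^sub>D_def)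
      show "D u \<cdot> \<mu> i = \<mu> j" if "u \<in> Hom cospan i j" for i j u
        using that r ide_left by (auto simp: cospan_simps D_def O\<^sub>D_def)
    qed
  qed
  have "pullback A f g L (\<pi> 0) (\<pi> 1)"
    unfolding pullback_def
  proof (rule exI[of _ X], rule exI[of _ Y], rule exI[of _ V], intro conjI allI ballI impI)
    show "f \<in> Hom A X V" "g \<in> Hom A Y V" by fact+
    show c: "\<pi> 0 \<in> Hom A L X" "\<pi> 1 \<in> Hom A L Y" "f \<cdot> \<pi> 0 = g \<cdot> \<pi> 1"
      using L cone_iff unfolding limit_def by auto
    have c2: "f \<cdot> \<pi> 0 = \<pi> 2" using L cone_iff unfolding limit_def by auto
    fix Z a b assume ab: "a \<in> Hom A Z X" "b \<in> Hom A Z Y" "f \<cdot> a = g \<cdot> b"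
    define \<mu> where "\<mu> = (\<lambda>i::nat. if i = 0 then a else if i = 1 then b else f \<cdot> a)"
    have "cone cospan A O\<^sub>D D Z \<mu>" using ab cmp_hom[OF ab(1) f] by (simp add: cone_iff \<mu>_def)
    then have "\<exists>!h. h \<in> Hom A Z L \<and> (\<forall>i\<in>Ob cospan. \<pi> i \<cdot> h = \<mu> i)"
      using L unfolding limit_def by blast
    \<comment> \<open>The leg to \<open>V\<close> is \<open>f\<close> after the leg to
      \<open>X\<close>, so the condition at index 2 follows from the one at index 0, and the
      mediating arrow of the limit is that of the pullback.\<close>
    moreover have "(\<forall>i\<in>Ob cospan. \<pi> i \<cdot> h = \<mu> i) \<longleftrightarrow> \<pi> 0 \<cdot> h = a \<and> \<pi> 1 \<cdot> h = b"
      if "h \<in> Hom A Z L" for h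
      using cmp_eq_extend1[OF c2 c(1) f that] by (auto simp: cospan_simps \<mu>_def)
    ultimately show "\<exists>!c. c \<in> Hom A Z L \<and> \<pi> 0 \<cdot> c = a \<and> \<pi> 1 \<cdot> c = b"
      by (simp cong: conj_cong)
  qed
  then show ?thesis by blast
qed

end

section \<open>Points of relations\<close>

text \<open>The pairs of arrows on \<open>P\<close> that factor through \<open>R\<close>, that is,
  generalized elements of shape \<open>P\<close>. The factorization itself is forgotten, so that a
  pseudo-relation and the relation which is its image can have the same points.\<close>

definition points :: "('o, 'm) cat \<Rightarrow> 'o \<Rightarrow> 'm \<times> 'm \<Rightarrow> ('m \<times> 'm) set" where
  "points A P R = {(fst R \<cdot>\<^bsub>A\<^esub> a, snd R \<cdot>\<^bsub>A\<^esub> a) | a. a \<in> Hom A P (Dom A (fst R))}"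

text \<open>Stated as inclusions, so that the last three can be matched with the factorizations in
  \<open>equivalence_relation\<close> and in \<open>pseudo_equivalence_relation\<close>.\<close>

definition equivalence_on :: "'a set \<Rightarrow> ('a \<times> 'a) set \<Rightarrow> bool" where
  "equivalence_on S E \<longleftrightarrow> E \<subseteq> S \<times> S \<and> Id_on S \<subseteq> E \<and> E\<inverse> \<subseteq> E \<and> E O E \<subseteq> E"

context category
begin

lemma points_iff:
  assumes "r\<^sub>1 \<in> Hom A R X"
  shows "(x, y) \<in> points A P (r\<^sub>1, r\<^sub>2) \<longleftrightarrow> (\<exists>a\<in>Hom A P R. x = r\<^sub>1 \<cdot> a \<and> y = r\<^sub>2 \<cdot> a)"
  using assms by (auto simp: points_def Hom_def)

lemma relation_hom:
  assumes "relation A X Y (r\<^sub>1, r\<^sub>2)"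
  obtains R where "r\<^sub>1 \<in> Hom A R X" "r\<^sub>2 \<in> Hom A R Y"
proof -
  obtain P p q m where P: "is_product A X Y P p q" and m: "monomorphism A m" "Cod A m = P"
    and R: "(r\<^sub>1, r\<^sub>2) = (p \<cdot> m, q \<cdot> m)"
    using assms unfolding relation_def by blast
  have "p \<in> Hom A P X" "q \<in> Hom A P Y" "m \<in> Hom A (Dom A m) P"
    using P m by (auto simp: is_product_def monomorphism_def Hom_def)
  then have "p \<cdot> m \<in> Hom A (Dom A m) X" "q \<cdot> m \<in> Hom A (Dom A m) Y" using cmp_hom by blast+
  then show thesis using that R by simp
qed

text \<open>An arrow into a product is determined by its components, which gives
  \<open>m \<cdot> a = m \<cdot> b\<close>; then the monomorphism \<open>m\<close> is
  cancelled.\<close>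

lemma relation_jointly_monic:
  assumes "relation A X Y (r\<^sub>1, r\<^sub>2)" "r\<^sub>1 \<in> Hom A R X" "a \<in> Hom A W R" "b \<in> Hom A W R"
    and "r\<^sub>1 \<cdot> a = r\<^sub>1 \<cdot> b" "r\<^sub>2 \<cdot> a = r\<^sub>2 \<cdot> b"
  shows "a = b"
proof -
  obtain P p q m where P: "is_product A X Y P p q" and m: "monomorphism A m" "Cod A m = P"
    and R: "(r\<^sub>1, r\<^sub>2) = (p \<cdot> m, q \<cdot> m)"
    using assms(1) unfolding relation_def by blast
  have pq: "p \<in> Hom A P X" "q \<in> Hom A P Y" and mh: "m \<in> Hom A (Dom A m) P"
    using P m by (auto simp: is_product_def monomorphism_def Hom_def)
  have D: "Dom A m = R" using R cmp_hom[OF mh pq(1)] assms(2) by (simp add: Hom_def)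
  have h: "m \<cdot> a \<in> Hom A W P" "m \<cdot> b \<in> Hom A W P" using assms(3,4) mh D cmp_hom by blast+
  have eq: "p \<cdot> (m \<cdot> a) = p \<cdot> (m \<cdot> b)" "q \<cdot> (m \<cdot> a) = q \<cdot> (m \<cdot> b)"
    using assms(5,6) R assoc[OF assms(3) mh[unfolded D] pq(1)] assoc[OF assms(3) mh[unfolded D] pq(2)]
      assoc[OF assms(4) mh[unfolded D] pq(1)] assoc[OF assms(4) mh[unfolded D] pq(2)] by auto
  have "\<exists>!c. c \<in> Hom A W P \<and> p \<cdot> c = p \<cdot> (m \<cdot> a) \<and> q \<cdot> c = q \<cdot> (m \<cdot> a)"
    using P cmp_hom[OF h(1) pq(1)] cmp_hom[OF h(1) pq(2)] unfolding is_product_def by blast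
  then have "m \<cdot> a = m \<cdot> b" using h eq by metis
  then show "a = b" using m(1) assms(3,4) D unfolding monomorphism_def by blast
qed

lemma points_subset:
  assumes "r\<^sub>1 \<in> Hom A R X" "r\<^sub>2 \<in> Hom A R Y"
  shows "points A P (r\<^sub>1, r\<^sub>2) \<subseteq> Hom A P X \<times> Hom A P Y"
  using assms cmp_hom by (auto simp: points_iff[OF assms(1)])

lemma points_Ide: "X \<in> Ob A \<Longrightarrow> points A P (Ide A X, Ide A X) = Id_on (Hom A P X)"
  using ide_left by (force simp: points_iff[OF ide_hom])

lemma points_converse:
  assumes "r\<^sub>1 \<in> Hom A R X" "r\<^sub>2 \<in> Hom A R Y"
  shows "points A P (r\<^sub>2, r\<^sub>1) = (points A P (r\<^sub>1, r\<^sub>2))\<inverse>"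
  by (auto simp: points_iff[OF assms(1)] points_iff[OF assms(2)])

lemma points_cmp_iff:
  assumes r: "r\<^sub>1 \<in> Hom A R X" "r\<^sub>2 \<in> Hom A R X" and f: "f \<in> Hom A X Y"
  shows "(u, v) \<in> points A P (f \<cdot> r\<^sub>1, f \<cdot> r\<^sub>2) \<longleftrightarrow> (\<exists>x y. (x, y) \<in> points A P (r\<^sub>1, r\<^sub>2) \<and> u = f \<cdot> x \<and> v = f \<cdot> y)"
  using assoc[OF _ r(1) f] assoc[OF _ r(2) f]
  by (auto simp: points_iff[OF cmp_hom[OF r(1) f]] points_iff[OF r(1)])

text \<open>The ambient objects of the two pairs may differ, since
  \<open>equivalence_relation\<close> and \<open>rel_comp3\<close> leave the objects of the
  composites under an existential quantifier.\<close>

lemma rel_le_points: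
  assumes r: "r\<^sub>1 \<in> Hom A R X" "r\<^sub>2 \<in> Hom A R Y" and s: "s\<^sub>1 \<in> Hom A S X'" "s\<^sub>2 \<in> Hom A S Y'"
    and le: "rel_le A (r\<^sub>1, r\<^sub>2) (s\<^sub>1, s\<^sub>2)"
  shows "points A P (r\<^sub>1, r\<^sub>2) \<subseteq> points A P (s\<^sub>1, s\<^sub>2)"
proof (rule subrelI)
  have "Dom A r\<^sub>1 = R" "Dom A s\<^sub>1 = S" using r s by (auto simp: Hom_def)
  then obtain h where h: "h \<in> Hom A R S" "s\<^sub>1 \<cdot> h = r\<^sub>1" "s\<^sub>2 \<cdot> h = r\<^sub>2" using le unfolding rel_le_def by auto
  fix x y assume "(x, y) \<in> points A P (r\<^sub>1, r\<^sub>2)"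
  then obtain a where a: "a \<in> Hom A P R" "x = r\<^sub>1 \<cdot> a" "y = r\<^sub>2 \<cdot> a" using points_iff[OF r(1)] by blast
  have "x = s\<^sub>1 \<cdot> (h \<cdot> a)" "y = s\<^sub>2 \<cdot> (h \<cdot> a)"
    using assoc[OF a(1) h(1) s(1)] assoc[OF a(1) h(1) s(2)] a h by auto
  then show "(x, y) \<in> points A P (s\<^sub>1, s\<^sub>2)" using points_iff[OF s(1)] cmp_hom[OF a(1) h(1)] by blast
qed

lemma jointly_monic_relation:
  assumes "has_finite_limits A" "r\<^sub>1 \<in> Hom A R X" "r\<^sub>2 \<in> Hom A R Y"
    and monic: "\<And>W a b. a \<in> Hom A W R \<Longrightarrow> b \<in> Hom A W R \<Longrightarrow> r\<^sub>1 \<cdot> a = r\<^sub>1 \<cdot> b \<Longrightarrow> r\<^sub>2 \<cdot> a = r\<^sub>2 \<cdot> b \<Longrightarrow> a = b"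
  shows "relation A X Y (r\<^sub>1, r\<^sub>2)"
proof -
  obtain P p q where P: "is_product A X Y P p q"
    using ex_product[OF assms(1)] hom_ob assms(2,3) by blast
  have pq: "p \<in> Hom A P X" "q \<in> Hom A P Y" using P unfolding is_product_def by auto
  obtain m where m: "m \<in> Hom A R P" "p \<cdot> m = r\<^sub>1" "q \<cdot> m = r\<^sub>2"
    using P assms(2,3) unfolding is_product_def by blast
  have "monomorphism A m"
    unfolding monomorphism_def
  proof (intro conjI allI ballI impI)
    show "m \<in> Ar A" using m by (simp add: Hom_def)
    fix Z a b assume "a \<in> Hom A Z (Dom A m)" "b \<in> Hom A Z (Dom A m)" and eq: "m \<cdot> a = m \<cdot> b"
    then have ab: "a \<in> Hom A Z R" "b \<in> Hom A Z R" using m(1) by (auto simp: Hom_def)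
    show "a = b"
    proof (rule monic[OF ab])
      show "r\<^sub>1 \<cdot> a = r\<^sub>1 \<cdot> b"
        using cmp_eq_extend1[OF m(2) m(1) pq(1) ab(1)] cmp_eq_extend1[OF m(2) m(1) pq(1) ab(2)] eq by simp
      show "r\<^sub>2 \<cdot> a = r\<^sub>2 \<cdot> b"
        using cmp_eq_extend1[OF m(3) m(1) pq(2) ab(1)] cmp_eq_extend1[OF m(3) m(1) pq(2) ab(2)] eq by simp
    qed
  qed
  then show ?thesis using P m unfolding relation_def Hom_def by blast
qed

end

section \<open>Regular categories with a projective cover: weak limits and images\<close>

locale projective_covering = category A for A :: "('o, 'm) cat" (structure) +
  fixes C :: "('o, 'm) cat"
  assumes regular: "regular_category A" and projective_cover: "projective_cover C A"
begin

lemma finite_limits: "has_finite_limits A"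
  using regular unfolding regular_category_def by simp

lemma full: "full_subcategory C A"
  using projective_cover unfolding projective_cover_def by simp

lemma category_C: "category C"
  using full unfolding full_subcategory_def by simp

lemma Ob_C: "X \<in> Ob C \<Longrightarrow> X \<in> Ob A"
  using full unfolding full_subcategory_def by blast

lemma Hom_C_iff: "f \<in> Hom C X Y \<longleftrightarrow> X \<in> Ob C \<and> Y \<in> Ob C \<and> f \<in> Hom A X Y"
proof -
  have "X \<in> Ob C \<and> Y \<in> Ob C" if "f \<in> Hom C X Y"
    using category.hom_ob[OF category_C that] by blast
  then show ?thesis using full unfolding full_subcategory_def by blast
qed

lemma Hom_C_eq: "X \<in> Ob C \<Longrightarrow> Y \<in> Ob C \<Longrightarrow> Hom C X Y = Hom A X Y"
  using Hom_C_iff by blast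

lemma Ide_C: "X \<in> Ob C \<Longrightarrow> Ide C X = Ide A X"
  using full unfolding full_subcategory_def by blast

lemma cmp_C: "f \<in> Hom C X Y \<Longrightarrow> g \<in> Hom C Y Z \<Longrightarrow> g \<cdot>\<^bsub>C\<^esub> f = g \<cdot> f"
  using full unfolding full_subcategory_def by blast

lemma lift:
  assumes "P \<in> Ob C" "f \<in> Hom A P X" "g \<in> Hom A Y X" "regular_epi A g"
  obtains h where "h \<in> Hom A P Y" "g \<cdot> h = f"
  using assms projective_cover unfolding projective_cover_def regular_projective_def by blast

lemma cover:
  assumes "X \<in> Ob A"
  obtains P e where "P \<in> Ob C" "e \<in> Hom A P X" "regular_epi A e"
  using assms projective_cover unfolding projective_cover_def by blast

text \<open>A cover \<open>P\<close> of the limit \<open>L\<close> in \<open>A\<close> is a weak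
  limit in \<open>C\<close>. A cone with vertex in \<open>C\<close> factors through
  \<open>L\<close>, and projectivity of the vertex lifts the factorization to \<open>P\<close>; the
  choice of the lift is where uniqueness is lost.\<close>

lemma weakly_lex_C: "weakly_lex C"
  unfolding weakly_lex_def
proof (intro conjI allI impI)
  show "category C" by (rule category_C)
  fix J :: "(nat, nat) cat" and D\<^sub>o D assume J: "finite (Ob J) \<and> finite (Ar J) \<and> is_functor J C D\<^sub>o D"
  then have fin: "finite (Ob J)" "finite (Ar J)" and F: "category J"
    "\<And>i. i \<in> Ob J \<Longrightarrow> D\<^sub>o i \<in> Ob C"
    "\<And>i j u. u \<in> Hom J i j \<Longrightarrow> D u \<in> Hom C (D\<^sub>o i) (D\<^sub>o j)"
    "\<And>i. i \<in> Ob J \<Longrightarrow> D (Ide J i) = Ide C (D\<^sub>o i)"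
    "\<And>i j k u v. u \<in> Hom J i j \<Longrightarrow> v \<in> Hom J j k \<Longrightarrow> D (v \<cdot>\<^bsub>J\<^esub> u) = D v \<cdot>\<^bsub>C\<^esub> D u"
    unfolding is_functor_def by auto
  have "is_functor J A D\<^sub>o D"
    unfolding is_functor_def
  proof (intro conjI allI ballI)
    show "category J" "category A" by (rule F(1), rule category_axioms)
    show "D\<^sub>o i \<in> Ob A" if "i \<in> Ob J" for i using that F(2) Ob_C by blast
    show "D u \<in> Hom A (D\<^sub>o i) (D\<^sub>o j)" if "u \<in> Hom J i j" for i j u
      using F(3)[OF that] Hom_C_iff by blast
    show "D (Ide J i) = Ide A (D\<^sub>o i)" if "i \<in> Ob J" for i using that F(2,4) Ide_C by simp
    show "D (v \<cdot>\<^bsub>J\<^esub> u) = D v \<cdot> D u" if "u \<in> Hom J i j" "v \<in> Hom J j k" for i j k u v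
      using F(5)[OF that] cmp_C[OF F(3)[OF that(1)] F(3)[OF that(2)]] by simp
  qed
  then obtain L \<pi> where "limit J A D\<^sub>o D L \<pi>"
    using fin finite_limits unfolding has_finite_limits_def by blast
  then have L: "cone J A D\<^sub>o D L \<pi>"
    and U: "\<And>M \<mu>. cone J A D\<^sub>o D M \<mu> \<Longrightarrow> \<exists>!h. h \<in> Hom A M L \<and> (\<forall>i\<in>Ob J. \<pi> i \<cdot> h = \<mu> i)"
    unfolding limit_def by blast+
  have Lc: "L \<in> Ob A" "\<And>i. i \<in> Ob J \<Longrightarrow> \<pi> i \<in> Hom A L (D\<^sub>o i)"
    "\<And>i j u. u \<in> Hom J i j \<Longrightarrow> D u \<cdot> \<pi> i = \<pi> j"
    using L unfolding cone_def by auto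
  obtain P e where P: "P \<in> Ob C" "e \<in> Hom A P L" "regular_epi A e" using cover[OF Lc(1)] .
  have cone_C: "cone J C D\<^sub>o D M \<mu> \<longleftrightarrow> M \<in> Ob C \<and> cone J A D\<^sub>o D M \<mu>" for M \<mu>
  proof -
    have "i \<in> Ob J" if "u \<in> Hom J i j" for i j u using that category.hom_ob[OF F(1)] by blast
    then have *: "D u \<cdot>\<^bsub>C\<^esub> \<mu> i = D u \<cdot> \<mu> i" if "u \<in> Hom J i j" "\<forall>i\<in>Ob J. \<mu> i \<in> Hom C M (D\<^sub>o i)" for i j u
      using that cmp_C F(3) by blast
    have **: "(\<forall>i\<in>Ob J. \<mu> i \<in> Hom C M (D\<^sub>o i)) \<longleftrightarrow> (\<forall>i\<in>Ob J. \<mu> i \<in> Hom A M (D\<^sub>o i))" if "M \<in> Ob C"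
      using that Hom_C_iff F(2) by blast
    show ?thesis unfolding cone_def using * ** Ob_C by (auto simp: Hom_C_iff)
  qed
  show "\<exists>L \<pi>. weak_limit J C D\<^sub>o D L \<pi>"
    unfolding weak_limit_def
  proof (rule exI[of _ P], rule exI[of _ "\<lambda>i. \<pi> i \<cdot> e"], intro conjI allI impI)
    show "cone J C D\<^sub>o D P (\<lambda>i. \<pi> i \<cdot> e)"
      unfolding cone_C
      unfolding cone_def
    proof (intro conjI allI ballI)
      show "P \<in> Ob C" "P \<in> Ob A" using P(1) Ob_C by auto
      show "\<pi> i \<cdot> e \<in> Hom A P (D\<^sub>o i)" if "i \<in> Ob J" for i using cmp_hom[OF P(2) Lc(2)[OF that]] .
      show "D u \<cdot> (\<pi> i \<cdot> e) = \<pi> j \<cdot> e" if "u \<in> Hom J i j" for i j u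
        using cmp_eq_extend1[OF Lc(3)[OF that] Lc(2) _ P(2)] F(3)[OF that] Hom_C_iff
          category.hom_ob[OF F(1) that] by blast
    qed
    fix M \<mu> assume "cone J C D\<^sub>o D M \<mu>"
    then have M: "M \<in> Ob C" "cone J A D\<^sub>o D M \<mu>" using cone_C by auto
    obtain h where h: "h \<in> Hom A M L" "\<forall>i\<in>Ob J. \<pi> i \<cdot> h = \<mu> i" using U[OF M(2)] by blast
    obtain k where k: "k \<in> Hom A M P" "e \<cdot> k = h" using lift[OF M(1) h(1) P(2,3)] .
    have "(\<pi> i \<cdot> e) \<cdot>\<^bsub>C\<^esub> k = \<mu> i" if i: "i \<in> Ob J" for i
    proof -
      have "(\<pi> i \<cdot> e) \<cdot>\<^bsub>C\<^esub> k = (\<pi> i \<cdot> e) \<cdot> k"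
        using cmp_C[of k M P "\<pi> i \<cdot> e" "D\<^sub>o i"] Hom_C_iff M(1) P(1) k(1) F(2)[OF i]
          cmp_hom[OF P(2) Lc(2)[OF i]] by blast
      also have "\<dots> = \<mu> i" using assoc[OF k(1) P(2) Lc(2)[OF i]] k(2) h(2) i by simp
      finally show ?thesis .
    qed
    then show "\<exists>h. h \<in> Hom C M P \<and> (\<forall>i\<in>Ob J. (\<pi> i \<cdot> e) \<cdot>\<^bsub>C\<^esub> h = \<mu> i)"
      using k(1) M(1) P(1) Hom_C_iff by blast
  qed
qed

text \<open>\<open>e\<close> is the coequalizer of the kernel pair of \<open>f\<close>, and
  \<open>m\<close> is the induced arrow. To see that \<open>m\<close> is monic, two arrows into
  \<open>I\<close> identified by \<open>m\<close> are restricted to a cover of their domain and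
  lifted along \<open>e\<close>; the lifts are identified by \<open>f\<close>, hence come from the
  kernel pair, hence are identified by \<open>e\<close>.\<close>

lemma image_factorization:
  assumes f: "f \<in> Hom A X Y"
  obtains I e m where "e \<in> Hom A X I" "regular_epi A e" "m \<in> Hom A I Y" "m \<cdot> e = f"
    "\<And>Z a b. a \<in> Hom A Z I \<Longrightarrow> b \<in> Hom A Z I \<Longrightarrow> m \<cdot> a = m \<cdot> b \<Longrightarrow> a = b"
proof -
  obtain K p q where K: "pullback A f f K p q" using ex_pullback[OF finite_limits f f] by blast
  note k = pullbackE[OF K f f]
  obtain e where e: "coequalizer A p q e"
    using K regular unfolding regular_category_def kernel_pair_def by blast
  then obtain I where eI: "e \<in> Hom A X I" "e \<cdot> p = e \<cdot> q"
    and U: "\<And>T t. t \<in> Hom A X T \<Longrightarrow> t \<cdot> p = t \<cdot> q \<Longrightarrow> \<exists>!h. h \<in> Hom A I T \<and> h \<cdot> e = t"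
    using k(1,2) unfolding coequalizer_def by (auto simp: Hom_def)
  obtain m where m: "m \<in> Hom A I Y" "m \<cdot> e = f" using U[OF f k(3)] by blast
  have re: "regular_epi A e" using e unfolding regular_epi_def by blast
  show thesis
  proof (rule that[OF eI(1) re m])
    fix Z a b assume ab: "a \<in> Hom A Z I" "b \<in> Hom A Z I" and eq: "m \<cdot> a = m \<cdot> b"
    obtain P z where P: "P \<in> Ob C" "z \<in> Hom A P Z" "regular_epi A z"
      using cover hom_ob(1)[OF ab(1)] by blast
    obtain a' where a': "a' \<in> Hom A P X" "e \<cdot> a' = a \<cdot> z"
      using lift[OF P(1) cmp_hom[OF P(2) ab(1)] eI(1) re] .
    obtain b' where b': "b' \<in> Hom A P X" "e \<cdot> b' = b \<cdot> z"
      using lift[OF P(1) cmp_hom[OF P(2) ab(2)] eI(1) re] .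
    have "f \<cdot> a' = f \<cdot> b'"
      using m eq a' b' assoc[OF a'(1) eI(1) m(1)] assoc[OF b'(1) eI(1) m(1)]
        assoc[OF P(2) ab(1) m(1)] assoc[OF P(2) ab(2) m(1)] by simp
    then obtain c where c: "c \<in> Hom A P K" "p \<cdot> c = a'" "q \<cdot> c = b'" using k(4)[OF a'(1) b'(1)] by blast
    have "a \<cdot> z = b \<cdot> z" using cmp_eq_extend[OF eI(2) k(1) eI(1) k(2) eI(1) c(1)] c a' b' by simp
    then show "a = b" using epi_cancel[OF P(3,2) ab] by blast
  qed
qed

section \<open>Relations of \<open>A\<close> read through their points\<close>

text \<open>For the converse the identity of \<open>R\<close> would be the natural test, but
  \<open>R\<close> need not lie in \<open>C\<close>. A cover \<open>e\<close> of \<open>R\<close> is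
  tested instead; the resulting \<open>h\<close> identifies whatever \<open>e\<close> identifies, as
  \<open>S\<close> is jointly monic, and so descends to \<open>R\<close>.\<close>

lemma rel_le_iff:
  assumes r: "r\<^sub>1 \<in> Hom A R X" "r\<^sub>2 \<in> Hom A R Y" and S: "relation A X Y S"
  shows "rel_le A (r\<^sub>1, r\<^sub>2) S \<longleftrightarrow> (\<forall>P\<in>Ob C. points A P (r\<^sub>1, r\<^sub>2) \<subseteq> points A P S)"
proof -
  obtain s\<^sub>1 s\<^sub>2 where Seq: "S = (s\<^sub>1, s\<^sub>2)" by (cases S)
  obtain Z where s: "s\<^sub>1 \<in> Hom A Z X" "s\<^sub>2 \<in> Hom A Z Y" by (rule relation_hom[OF S[unfolded Seq]])
  note monic = relation_jointly_monic[OF S[unfolded Seq] s(1)]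
  show ?thesis
  proof
    show "\<forall>P\<in>Ob C. points A P (r\<^sub>1, r\<^sub>2) \<subseteq> points A P S" if "rel_le A (r\<^sub>1, r\<^sub>2) S"
      using rel_le_points[OF r s] that unfolding Seq by blast
  next
    assume pts: "\<forall>P\<in>Ob C. points A P (r\<^sub>1, r\<^sub>2) \<subseteq> points A P S"
    obtain P e where P: "P \<in> Ob C" "e \<in> Hom A P R" "regular_epi A e" using cover hom_ob(1)[OF r(1)] by blast
    have "(r\<^sub>1 \<cdot> e, r\<^sub>2 \<cdot> e) \<in> points A P S" using pts points_iff[OF r(1)] P by blast
    then obtain h where h: "h \<in> Hom A P Z" "s\<^sub>1 \<cdot> h = r\<^sub>1 \<cdot> e" "s\<^sub>2 \<cdot> h = r\<^sub>2 \<cdot> e"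
      unfolding Seq using points_iff[OF s(1)] by metis
    have "h \<cdot> u = h \<cdot> v" if uv: "u \<in> Hom A W P" "v \<in> Hom A W P" "e \<cdot> u = e \<cdot> v" for W u v
    proof (rule monic[OF cmp_hom[OF uv(1) h(1)] cmp_hom[OF uv(2) h(1)]])
      show "s\<^sub>1 \<cdot> (h \<cdot> u) = s\<^sub>1 \<cdot> (h \<cdot> v)"
        using cmp_eq_extend[OF h(2) h(1) s(1) P(2) r(1) uv(1)] cmp_eq_extend[OF h(2) h(1) s(1) P(2) r(1) uv(2)]
          uv(3) by simp
      show "s\<^sub>2 \<cdot> (h \<cdot> u) = s\<^sub>2 \<cdot> (h \<cdot> v)"
        using cmp_eq_extend[OF h(3) h(1) s(2) P(2) r(2) uv(1)] cmp_eq_extend[OF h(3) h(1) s(2) P(2) r(2) uv(2)]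
          uv(3) by simp
    qed
    then obtain k where k: "k \<in> Hom A R Z" "k \<cdot> e = h"
      using regular_epi_factor[OF P(3,2) h(1)] by blast
    have "(s\<^sub>1 \<cdot> k) \<cdot> e = r\<^sub>1 \<cdot> e" "(s\<^sub>2 \<cdot> k) \<cdot> e = r\<^sub>2 \<cdot> e"
      using assoc[OF P(2) k(1) s(1)] assoc[OF P(2) k(1) s(2)] k h by auto
    then have "s\<^sub>1 \<cdot> k = r\<^sub>1" "s\<^sub>2 \<cdot> k = r\<^sub>2"
      using epi_cancel[OF P(3,2) cmp_hom[OF k(1) s(1)] r(1)] epi_cancel[OF P(3,2) cmp_hom[OF k(1) s(2)] r(2)]
      by auto
    then show "rel_le A (r\<^sub>1, r\<^sub>2) S" using k(1) r(1) s(1) unfolding rel_le_def Seq by (auto simp: Hom_def)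
  qed
qed

text \<open>A point of the pullback \<open>W\<close> is a pair of points of \<open>R\<close> and
  \<open>S\<close> with a common middle term, and \<open>e\<close> is surjective on points because
  \<open>P\<close> is projective. The orders differ: \<open>O\<close> composes from left to right,
  while \<open>rel_comp\<close> lists the relation applied last in front.\<close>

lemma points_rel_comp:
  assumes "rel_comp A S R T" "P \<in> Ob C"
  shows "points A P T = points A P R O points A P S"
proof -
  obtain X Y Z W p q e where rel: "relation A X Y R" "relation A Y Z S" "relation A X Z T"
    and W: "pullback A (snd R) (fst S) W p q"
    and e: "e \<in> Hom A W (Dom A (fst T))" "regular_epi A e"
      "fst T \<cdot> e = fst R \<cdot> p" "snd T \<cdot> e = snd S \<cdot> q"
    using assms(1) unfolding rel_comp_def by blast
  obtain r\<^sub>1 r\<^sub>2 s\<^sub>1 s\<^sub>2 t\<^sub>1 t\<^sub>2 where eqs: "R = (r\<^sub>1, r\<^sub>2)" "S = (s\<^sub>1, s\<^sub>2)" "T = (t\<^sub>1, t\<^sub>2)"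
    by (cases R, cases S, cases T)
  obtain R' where r: "r\<^sub>1 \<in> Hom A R' X" "r\<^sub>2 \<in> Hom A R' Y"
    by (rule relation_hom[OF rel(1)[unfolded eqs]])
  obtain S' where s: "s\<^sub>1 \<in> Hom A S' Y" "s\<^sub>2 \<in> Hom A S' Z"
    by (rule relation_hom[OF rel(2)[unfolded eqs]])
  obtain T' where t: "t\<^sub>1 \<in> Hom A T' X" "t\<^sub>2 \<in> Hom A T' Z"
    by (rule relation_hom[OF rel(3)[unfolded eqs]])
  have e': "e \<in> Hom A W T'" using e(1) t by (simp add: eqs Hom_def)
  note w = pullbackE[OF W[unfolded eqs fst_conv snd_conv] r(2) s(1)]
  note pts = points_iff[OF r(1)] points_iff[OF s(1)] points_iff[OF t(1)]
  have te: "t\<^sub>1 \<cdot> e = r\<^sub>1 \<cdot> p" "t\<^sub>2 \<cdot> e = s\<^sub>2 \<cdot> q" using e eqs by auto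
  have "(x, z) \<in> points A P T \<longleftrightarrow> (x, z) \<in> points A P R O points A P S" for x z
  proof
    assume "(x, z) \<in> points A P T"
    then obtain a where a: "a \<in> Hom A P T'" "x = t\<^sub>1 \<cdot> a" "z = t\<^sub>2 \<cdot> a" unfolding eqs pts by blast
    obtain c where c: "c \<in> Hom A P W" "e \<cdot> c = a" using lift[OF assms(2) a(1) e' e(2)] .
    have "x = r\<^sub>1 \<cdot> (p \<cdot> c)" "z = s\<^sub>2 \<cdot> (q \<cdot> c)" "r\<^sub>2 \<cdot> (p \<cdot> c) = s\<^sub>1 \<cdot> (q \<cdot> c)"
      using cmp_eq_extend[OF te(1) e' t(1) w(1) r(1) c(1)] cmp_eq_extend[OF te(2) e' t(2) w(2) s(2) c(1)]
        cmp_eq_extend[OF w(3) w(1) r(2) w(2) s(1) c(1)] a c by auto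
    moreover have "p \<cdot> c \<in> Hom A P R'" "q \<cdot> c \<in> Hom A P S'" using cmp_hom c w by blast+
    ultimately have "(x, r\<^sub>2 \<cdot> (p \<cdot> c)) \<in> points A P R" "(r\<^sub>2 \<cdot> (p \<cdot> c), z) \<in> points A P S"
      unfolding eqs pts by blast+
    then show "(x, z) \<in> points A P R O points A P S" by blast
  next
    assume "(x, z) \<in> points A P R O points A P S"
    then obtain a b where ab: "a \<in> Hom A P R'" "b \<in> Hom A P S'" "r\<^sub>2 \<cdot> a = s\<^sub>1 \<cdot> b" "x = r\<^sub>1 \<cdot> a" "z = s\<^sub>2 \<cdot> b"
      unfolding eqs by (auto simp: pts)
    then obtain c where c: "c \<in> Hom A P W" "p \<cdot> c = a" "q \<cdot> c = b" using w(4)[OF ab(1-3)] by blast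
    have "x = t\<^sub>1 \<cdot> (e \<cdot> c)" "z = t\<^sub>2 \<cdot> (e \<cdot> c)"
      using cmp_eq_extend[OF te(1) e' t(1) w(1) r(1) c(1)] cmp_eq_extend[OF te(2) e' t(2) w(2) s(2) c(1)]
        ab c by auto
    then show "(x, z) \<in> points A P T" unfolding eqs pts using cmp_hom[OF c(1) e'] by blast
  qed
  then show ?thesis by auto
qed

lemma image_relation:
  assumes r: "r\<^sub>1 \<in> Hom A R X" "r\<^sub>2 \<in> Hom A R Y"
  obtains I e t\<^sub>1 t\<^sub>2 where "e \<in> Hom A R I" "regular_epi A e" "t\<^sub>1 \<in> Hom A I X" "t\<^sub>2 \<in> Hom A I Y"
    "t\<^sub>1 \<cdot> e = r\<^sub>1" "t\<^sub>2 \<cdot> e = r\<^sub>2" "relation A X Y (t\<^sub>1, t\<^sub>2)"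
proof -
  obtain P x y where P: "is_product A X Y P x y" using ex_product[OF finite_limits] hom_ob r by blast
  have xy: "x \<in> Hom A P X" "y \<in> Hom A P Y" using P unfolding is_product_def by auto
  obtain c where c: "c \<in> Hom A R P" "x \<cdot> c = r\<^sub>1" "y \<cdot> c = r\<^sub>2" using P r unfolding is_product_def by blast
  obtain I e m where I: "e \<in> Hom A R I" "regular_epi A e" "m \<in> Hom A I P" "m \<cdot> e = c"
    and monic: "\<And>Z a b. a \<in> Hom A Z I \<Longrightarrow> b \<in> Hom A Z I \<Longrightarrow> m \<cdot> a = m \<cdot> b \<Longrightarrow> a = b"
    using image_factorization[OF c(1)] by blast
  have "monomorphism A m" unfolding monomorphism_def using I(3) monic by (auto simp: Hom_def)
  moreover have "Cod A m = P" using I(3) by (simp add: Hom_def)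
  ultimately have "relation A X Y (x \<cdot> m, y \<cdot> m)" unfolding relation_def using P by blast
  moreover have "(x \<cdot> m) \<cdot> e = r\<^sub>1" "(y \<cdot> m) \<cdot> e = r\<^sub>2"
    using assoc[OF I(1,3) xy(1)] assoc[OF I(1,3) xy(2)] I(4) c by auto
  ultimately show thesis using that I(1,2) cmp_hom[OF I(3) xy(1)] cmp_hom[OF I(3) xy(2)] by blast
qed

text \<open>This serves to trade a pseudo-relation for the relation that is its image, and to remove
  the regular epimorphism \<open>l\<close> in the kernel pair condition.\<close>

lemma points_regular_epi:
  assumes e: "e \<in> Hom A R I" "regular_epi A e" and t: "t\<^sub>1 \<in> Hom A I X" "t\<^sub>2 \<in> Hom A I Y" and P: "P \<in> Ob C"
  shows "points A P (t\<^sub>1 \<cdot> e, t\<^sub>2 \<cdot> e) = points A P (t\<^sub>1, t\<^sub>2)"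
proof -
  note pts = points_iff[OF t(1)] points_iff[OF cmp_hom[OF e(1) t(1)]]
  have "(x, y) \<in> points A P (t\<^sub>1 \<cdot> e, t\<^sub>2 \<cdot> e) \<longleftrightarrow> (x, y) \<in> points A P (t\<^sub>1, t\<^sub>2)" for x y
  proof
    assume "(x, y) \<in> points A P (t\<^sub>1 \<cdot> e, t\<^sub>2 \<cdot> e)"
    then obtain a where "a \<in> Hom A P R" "x = (t\<^sub>1 \<cdot> e) \<cdot> a" "y = (t\<^sub>2 \<cdot> e) \<cdot> a" unfolding pts by blast
    then show "(x, y) \<in> points A P (t\<^sub>1, t\<^sub>2)"
      unfolding pts using assoc[OF _ e(1) t(1)] assoc[OF _ e(1) t(2)] cmp_hom[OF _ e(1)] by blast
  next
    assume "(x, y) \<in> points A P (t\<^sub>1, t\<^sub>2)"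
    then obtain b where b: "b \<in> Hom A P I" "x = t\<^sub>1 \<cdot> b" "y = t\<^sub>2 \<cdot> b" unfolding pts by blast
    obtain a where a: "a \<in> Hom A P R" "e \<cdot> a = b" using lift[OF P b(1) e] .
    have "x = (t\<^sub>1 \<cdot> e) \<cdot> a" "y = (t\<^sub>2 \<cdot> e) \<cdot> a"
      using assoc[OF a(1) e(1) t(1)] assoc[OF a(1) e(1) t(2)] a b by auto
    then show "(x, y) \<in> points A P (t\<^sub>1 \<cdot> e, t\<^sub>2 \<cdot> e)" unfolding pts using a(1) by blast
  qed
  then show ?thesis by auto
qed

lemma ex_rel_comp:
  assumes R: "relation A X Y R" and S: "relation A Y Z S"
  obtains T where "rel_comp A S R T" "relation A X Z T"
proof -
  obtain r\<^sub>1 r\<^sub>2 s\<^sub>1 s\<^sub>2 where eqs: "R = (r\<^sub>1, r\<^sub>2)" "S = (s\<^sub>1, s\<^sub>2)" by (cases R, cases S)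
  obtain R' where r: "r\<^sub>1 \<in> Hom A R' X" "r\<^sub>2 \<in> Hom A R' Y"
    by (rule relation_hom[OF R[unfolded eqs]])
  obtain S' where s: "s\<^sub>1 \<in> Hom A S' Y" "s\<^sub>2 \<in> Hom A S' Z"
    by (rule relation_hom[OF S[unfolded eqs]])
  obtain W p q where W: "pullback A r\<^sub>2 s\<^sub>1 W p q" using ex_pullback[OF finite_limits r(2) s(1)] by blast
  note w = pullbackE[OF W r(2) s(1)]
  obtain I e t\<^sub>1 t\<^sub>2 where I: "e \<in> Hom A W I" "regular_epi A e" "t\<^sub>1 \<in> Hom A I X"
      "t\<^sub>1 \<cdot> e = r\<^sub>1 \<cdot> p" "t\<^sub>2 \<cdot> e = s\<^sub>2 \<cdot> q" and rel: "relation A X Z (t\<^sub>1, t\<^sub>2)"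
    using image_relation[OF cmp_hom[OF w(1) r(1)] cmp_hom[OF w(2) s(2)]] by metis
  have "Dom A t\<^sub>1 = I" using I(3) by (simp add: Hom_def)
  then have "rel_comp A S R (t\<^sub>1, t\<^sub>2)"
    unfolding rel_comp_def using R S W I rel unfolding eqs fst_conv snd_conv by blast
  then show thesis using that rel by blast
qed

lemma equivalence_relation_iff:
  assumes R: "relation A X X R"
  shows "equivalence_relation A X R \<longleftrightarrow> (\<forall>P\<in>Ob C. equivalence_on (Hom A P X) (points A P R))"
proof -
  obtain r\<^sub>1 r\<^sub>2 where eqs: "R = (r\<^sub>1, r\<^sub>2)" by (cases R)
  obtain R' where r: "r\<^sub>1 \<in> Hom A R' X" "r\<^sub>2 \<in> Hom A R' X" by (rule relation_hom[OF R[unfolded eqs]])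
  have X: "X \<in> Ob A" using hom_ob r by blast
  have refl: "rel_le A (Ide A X, Ide A X) R \<longleftrightarrow> (\<forall>P\<in>Ob C. Id_on (Hom A P X) \<subseteq> points A P R)"
    using rel_le_iff[OF ide_hom[OF X] ide_hom[OF X] R] points_Ide[OF X] by simp
  have sym: "rel_le A (snd R, fst R) R \<longleftrightarrow> (\<forall>P\<in>Ob C. (points A P R)\<inverse> \<subseteq> points A P R)"
    using rel_le_iff[OF r(2,1) R] points_converse[OF r] by (simp add: eqs)
  have le: "rel_le A T R \<longleftrightarrow> (\<forall>P\<in>Ob C. points A P R O points A P R \<subseteq> points A P R)"
    if T: "rel_comp A R R T" "relation A X X T" for T
  proof -
    obtain t\<^sub>1 t\<^sub>2 where T': "T = (t\<^sub>1, t\<^sub>2)" by (cases T)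
    obtain Z where "t\<^sub>1 \<in> Hom A Z X" "t\<^sub>2 \<in> Hom A Z X" by (rule relation_hom[OF T(2)[unfolded T']])
    from rel_le_iff[OF this R] show ?thesis using points_rel_comp[OF T(1)] unfolding T' by simp
  qed
  have trans: "(\<exists>T. rel_comp A R R T \<and> rel_le A T R) \<longleftrightarrow> (\<forall>P\<in>Ob C. points A P R O points A P R \<subseteq> points A P R)"
  proof
    assume "\<exists>T. rel_comp A R R T \<and> rel_le A T R"
    then obtain T where T: "rel_comp A R R T" "rel_le A T R" by blast
    \<comment> \<open>Only \<open>rel_comp\<close> is known of \<open>T\<close>, so its ambient
      objects are left open.\<close>
    obtain X' Z' where "relation A X' Z' T" using T(1) unfolding rel_comp_def by blast
    moreover obtain t\<^sub>1 t\<^sub>2 where T': "T = (t\<^sub>1, t\<^sub>2)" by (cases T)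
    ultimately obtain Z where "t\<^sub>1 \<in> Hom A Z X'" "t\<^sub>2 \<in> Hom A Z Z'" using relation_hom by metis
    from rel_le_points[OF this r] have "points A P T \<subseteq> points A P R" for P
      using T(2) unfolding T' eqs by simp
    then show "\<forall>P\<in>Ob C. points A P R O points A P R \<subseteq> points A P R"
      using points_rel_comp[OF T(1)] by metis
  next
    assume *: "\<forall>P\<in>Ob C. points A P R O points A P R \<subseteq> points A P R"
    obtain T where "rel_comp A R R T" "relation A X X T" using ex_rel_comp[OF R R] .
    then show "\<exists>T. rel_comp A R R T \<and> rel_le A T R" using le * by blast
  qed
  then show ?thesis
    unfolding equivalence_relation_def equivalence_on_def refl sym trans
    using R points_subset[OF r] unfolding eqs by blast
qed

text \<open>\<open>goursat\<close> asks for some composites, as these are unique only up to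
  \<open>rel_eq\<close>. All choices have the same points over \<open>C\<close>, so the equality of
  point sets does not depend on the choice.\<close>

lemma goursat_iff:
  "goursat A \<longleftrightarrow> (\<forall>X R S. equivalence_relation A X R \<and> equivalence_relation A X S \<longrightarrow>
     (\<forall>P\<in>Ob C. points A P R O points A P S O points A P R = points A P S O points A P R O points A P S))"
proof -
  have eq: "(\<exists>T T'. rel_comp3 A R S R T \<and> rel_comp3 A S R S T' \<and> rel_eq A T T') \<longleftrightarrow>
     (\<forall>P\<in>Ob C. points A P R O points A P S O points A P R = points A P S O points A P R O points A P S)"
    (is "?l \<longleftrightarrow> ?r")
    if E: "equivalence_relation A X R \<and> equivalence_relation A X S" for X R S
  proof -
    have rel: "relation A X X R" "relation A X X S" using E unfolding equivalence_relation_def by auto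
    have pts: "points A P T = points A P R O points A P S O points A P Q"
      if "rel_comp3 A Q S R T" "P \<in> Ob C" for Q R S T P
      using that points_rel_comp unfolding rel_comp3_def by (metis O_assoc)
    have ex: "\<exists>T. rel_comp3 A Q S R T \<and> relation A X X T"
      if QSR: "relation A X X Q" "relation A X X S" "relation A X X R" for Q S R
    proof -
      obtain U where U: "rel_comp A S R U" "relation A X X U" by (rule ex_rel_comp[OF QSR(3,2)])
      obtain T where "rel_comp A Q U T" "relation A X X T" by (rule ex_rel_comp[OF U(2) QSR(1)])
      then show ?thesis unfolding rel_comp3_def using U(1) by blast
    qed
    have mono: "points A P T \<subseteq> points A P T'"
      if le: "rel_le A T T'" and T: "relation A Y Z T" and T': "relation A Y' Z' T'" for P T T' Y Z Y' Z'
    proof -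
      obtain t\<^sub>1 t\<^sub>2 u\<^sub>1 u\<^sub>2 where eqs: "T = (t\<^sub>1, t\<^sub>2)" "T' = (u\<^sub>1, u\<^sub>2)" by (cases T, cases T')
      obtain D where t: "t\<^sub>1 \<in> Hom A D Y" "t\<^sub>2 \<in> Hom A D Z" by (rule relation_hom[OF T[unfolded eqs]])
      obtain D' where u: "u\<^sub>1 \<in> Hom A D' Y'" "u\<^sub>2 \<in> Hom A D' Z'" by (rule relation_hom[OF T'[unfolded eqs]])
      show ?thesis using rel_le_points[OF t u] le unfolding eqs by blast
    qed
    show ?thesis
    proof
      assume ?l
      then obtain T T' where T: "rel_comp3 A R S R T" "rel_comp3 A S R S T'" "rel_eq A T T'" by blast
      obtain Y Z Y' Z' where TT: "relation A Y Z T" "relation A Y' Z' T'"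
        using T(1,2) unfolding rel_comp3_def rel_comp_def by blast
      have "points A P T = points A P T'" for P
        using mono[OF _ TT] mono[OF _ TT(2,1)] T(3) unfolding rel_eq_def by blast
      then show ?r using pts[OF T(1)] pts[OF T(2)] by simp
    next
      assume r: ?r
      obtain T where T: "rel_comp3 A R S R T" "relation A X X T" using ex[OF rel(1,2,1)] by blast
      obtain T' where T': "rel_comp3 A S R S T'" "relation A X X T'" using ex[OF rel(2,1,2)] by blast
      have le: "rel_le A V V'" if V: "relation A X X V" and V': "relation A X X V'"
        and sub: "\<forall>P\<in>Ob C. points A P V \<subseteq> points A P V'" for V V'
      proof -
        obtain v\<^sub>1 v\<^sub>2 where eqs: "V = (v\<^sub>1, v\<^sub>2)" by (cases V)
        obtain D where v: "v\<^sub>1 \<in> Hom A D X" "v\<^sub>2 \<in> Hom A D X" by (rule relation_hom[OF V[unfolded eqs]])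
        show ?thesis using rel_le_iff[OF v V'] sub unfolding eqs by blast
      qed
      have "\<forall>P\<in>Ob C. points A P T = points A P T'" using pts[OF T(1)] pts[OF T'(1)] r by simp
      then have "rel_eq A T T'" unfolding rel_eq_def using le T(2) T'(2) by simp
      then show ?l using T(1) T'(1) by blast
    qed
  qed
  show ?thesis
    unfolding goursat_def by (simp only: regular simp_thms) (intro all_cong1 imp_cong refl, rule eq)
qed

section \<open>Weak pullbacks and pseudo-relations of \<open>C\<close> read through their
  points\<close>

text \<open>The vertex is a cover of the pullback in \<open>A\<close>. The objects \<open>X\<close>,
  \<open>Y\<close> and \<open>V\<close> range over \<open>A\<close>, because the lemma is also
  applied to relations of \<open>A\<close> and to arrows into a product formed in
  \<open>A\<close>.\<close>

lemma ex_weak_pullback: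
  assumes f: "f \<in> Hom A X V" and g: "g \<in> Hom A Y V"
  obtains P p q where "P \<in> Ob C" "p \<in> Hom A P X" "q \<in> Hom A P Y" "f \<cdot> p = g \<cdot> q"
    "\<forall>Z\<in>Ob C. \<forall>a\<in>Hom A Z X. \<forall>b\<in>Hom A Z Y. f \<cdot> a = g \<cdot> b \<longrightarrow> (\<exists>c\<in>Hom A Z P. p \<cdot> c = a \<and> q \<cdot> c = b)"
proof -
  obtain L x y where L: "pullback A f g L x y" using ex_pullback[OF finite_limits f g] by blast
  note l = pullbackE[OF L f g]
  obtain P e where P: "P \<in> Ob C" "e \<in> Hom A P L" "regular_epi A e" using cover hom_ob(1)[OF l(1)] by blast
  show thesis
  proof (rule that[of P "x \<cdot> e" "y \<cdot> e"])
    show "P \<in> Ob C" "x \<cdot> e \<in> Hom A P X" "y \<cdot> e \<in> Hom A P Y" "f \<cdot> (x \<cdot> e) = g \<cdot> (y \<cdot> e)"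
      using P cmp_hom[OF P(2)] l(1,2) cmp_eq_extend[OF l(3,1) f l(2) g P(2)] by auto
    show "\<forall>Z\<in>Ob C. \<forall>a\<in>Hom A Z X. \<forall>b\<in>Hom A Z Y. f \<cdot> a = g \<cdot> b \<longrightarrow>
      (\<exists>c\<in>Hom A Z P. (x \<cdot> e) \<cdot> c = a \<and> (y \<cdot> e) \<cdot> c = b)"
    proof (intro ballI impI)
      fix Z a b assume Z: "Z \<in> Ob C" and ab: "a \<in> Hom A Z X" "b \<in> Hom A Z Y" "f \<cdot> a = g \<cdot> b"
      obtain d where d: "d \<in> Hom A Z L" "x \<cdot> d = a" "y \<cdot> d = b" using l(4)[OF ab] by blast
      obtain c where c: "c \<in> Hom A Z P" "e \<cdot> c = d" using lift[OF Z d(1) P(2,3)] .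
      show "\<exists>c\<in>Hom A Z P. (x \<cdot> e) \<cdot> c = a \<and> (y \<cdot> e) \<cdot> c = b"
        using assoc[OF c(1) P(2) l(1)] assoc[OF c(1) P(2) l(2)] c d by auto
    qed
  qed
qed

lemma weak_pullback_iff:
  assumes ob: "X \<in> Ob C" "Y \<in> Ob C" "V \<in> Ob C" "P \<in> Ob C"
    and f: "f \<in> Hom A X V" and g: "g \<in> Hom A Y V" and p: "p \<in> Hom A P X" and q: "q \<in> Hom A P Y"
  shows "weak_pullback C f g P p q \<longleftrightarrow> f \<cdot> p = g \<cdot> q \<and>
    (\<forall>Z\<in>Ob C. \<forall>a\<in>Hom A Z X. \<forall>b\<in>Hom A Z Y. f \<cdot> a = g \<cdot> b \<longrightarrow> (\<exists>c\<in>Hom A Z P. p \<cdot> c = a \<and> q \<cdot> c = b))"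
proof -
  have h: "f \<in> Hom C X V" "g \<in> Hom C Y V" "p \<in> Hom C P X" "q \<in> Hom C P Y"
    using assms Hom_C_iff by auto
  have uniq: "X' = X \<and> Y' = Y \<and> V' = V" if "f \<in> Hom C X' V'" "g \<in> Hom C Y' V'" for X' Y' V'
    using that h(1,2) by (auto simp: Hom_def)
  have "weak_pullback C f g P p q \<longleftrightarrow> f \<cdot>\<^bsub>C\<^esub> p = g \<cdot>\<^bsub>C\<^esub> q \<and>
    (\<forall>Z. \<forall>a\<in>Hom C Z X. \<forall>b\<in>Hom C Z Y. f \<cdot>\<^bsub>C\<^esub> a = g \<cdot>\<^bsub>C\<^esub> b \<longrightarrow>
      (\<exists>c. c \<in> Hom C Z P \<and> p \<cdot>\<^bsub>C\<^esub> c = a \<and> q \<cdot>\<^bsub>C\<^esub> c = b))" (is "?l \<longleftrightarrow> ?r")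
  proof
    assume ?l
    then obtain X' Y' V' where *: "f \<in> Hom C X' V'" "g \<in> Hom C Y' V'" "f \<cdot>\<^bsub>C\<^esub> p = g \<cdot>\<^bsub>C\<^esub> q"
      "\<forall>Z. \<forall>a\<in>Hom C Z X'. \<forall>b\<in>Hom C Z Y'. f \<cdot>\<^bsub>C\<^esub> a = g \<cdot>\<^bsub>C\<^esub> b \<longrightarrow>
        (\<exists>c. c \<in> Hom C Z P \<and> p \<cdot>\<^bsub>C\<^esub> c = a \<and> q \<cdot>\<^bsub>C\<^esub> c = b)"
      unfolding weak_pullback_def by blast
    then show ?r using uniq[OF *(1,2)] by simp
  next
    assume ?r
    then show ?l unfolding weak_pullback_def using h by blast
  qed
  also have "\<dots> \<longleftrightarrow> f \<cdot> p = g \<cdot> q \<and>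
    (\<forall>Z\<in>Ob C. \<forall>a\<in>Hom C Z X. \<forall>b\<in>Hom C Z Y. f \<cdot> a = g \<cdot> b \<longrightarrow> (\<exists>c\<in>Hom C Z P. p \<cdot> c = a \<and> q \<cdot> c = b))"
    unfolding cmp_C[OF h(3,1)] cmp_C[OF h(4,2)]
    using cmp_C[OF _ h(1)] cmp_C[OF _ h(2)] cmp_C[OF _ h(3)] cmp_C[OF _ h(4)] Hom_C_iff by metis
  also have "\<dots> \<longleftrightarrow> f \<cdot> p = g \<cdot> q \<and>
    (\<forall>Z\<in>Ob C. \<forall>a\<in>Hom A Z X. \<forall>b\<in>Hom A Z Y. f \<cdot> a = g \<cdot> b \<longrightarrow> (\<exists>c\<in>Hom A Z P. p \<cdot> c = a \<and> q \<cdot> c = b))"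
    by (simp add: ob Hom_C_eq)
  finally show ?thesis .
qed

text \<open>The inclusion from left to right is
  \<open>f \<cdot> \<beta>\<^sub>1 = f \<cdot> \<beta>\<^sub>2\<close>, recovered at
  \<open>P = F\<close> from the identity of \<open>F\<close>; the other inclusion is the weak
  universal property.\<close>

lemma weak_kernel_pair_iff:
  assumes ob: "X \<in> Ob C" "Y \<in> Ob C" "F \<in> Ob C"
    and f: "f \<in> Hom A X Y" and b: "\<beta>\<^sub>1 \<in> Hom A F X" "\<beta>\<^sub>2 \<in> Hom A F X"
  shows "weak_kernel_pair C f F \<beta>\<^sub>1 \<beta>\<^sub>2 \<longleftrightarrow>
    (\<forall>P\<in>Ob C. points A P (\<beta>\<^sub>1, \<beta>\<^sub>2) = {(x, y) \<in> Hom A P X \<times> Hom A P X. f \<cdot> x = f \<cdot> y})" (is "_ \<longleftrightarrow> ?r")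
proof -
  have "f \<cdot> \<beta>\<^sub>1 = f \<cdot> \<beta>\<^sub>2 \<longleftrightarrow>
    (\<forall>P\<in>Ob C. points A P (\<beta>\<^sub>1, \<beta>\<^sub>2) \<subseteq> {(x, y) \<in> Hom A P X \<times> Hom A P X. f \<cdot> x = f \<cdot> y})"
  proof
    assume eq: "f \<cdot> \<beta>\<^sub>1 = f \<cdot> \<beta>\<^sub>2"
    show "\<forall>P\<in>Ob C. points A P (\<beta>\<^sub>1, \<beta>\<^sub>2) \<subseteq> {(x, y) \<in> Hom A P X \<times> Hom A P X. f \<cdot> x = f \<cdot> y}"
      using cmp_eq_extend[OF eq b(1) f b(2) f] cmp_hom b by (auto simp: points_iff[OF b(1)])
  next
    assume *: "\<forall>P\<in>Ob C. points A P (\<beta>\<^sub>1, \<beta>\<^sub>2) \<subseteq> {(x, y) \<in> Hom A P X \<times> Hom A P X. f \<cdot> x = f \<cdot> y}"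
    have "(\<beta>\<^sub>1, \<beta>\<^sub>2) \<in> points A F (\<beta>\<^sub>1, \<beta>\<^sub>2)"
      unfolding points_iff[OF b(1)] using ide_hom[OF Ob_C[OF ob(3)]] ide_right b by metis
    then show "f \<cdot> \<beta>\<^sub>1 = f \<cdot> \<beta>\<^sub>2" using * ob(3) by blast
  qed
  moreover have "(\<forall>Z\<in>Ob C. \<forall>a\<in>Hom A Z X. \<forall>b\<in>Hom A Z X. f \<cdot> a = f \<cdot> b \<longrightarrow>
      (\<exists>c\<in>Hom A Z F. \<beta>\<^sub>1 \<cdot> c = a \<and> \<beta>\<^sub>2 \<cdot> c = b)) \<longleftrightarrow>
    (\<forall>P\<in>Ob C. {(x, y) \<in> Hom A P X \<times> Hom A P X. f \<cdot> x = f \<cdot> y} \<subseteq> points A P (\<beta>\<^sub>1, \<beta>\<^sub>2))"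
    by (simp add: subset_iff points_iff[OF b(1)]) metis
  ultimately show ?thesis
    unfolding weak_kernel_pair_def weak_pullback_iff[OF ob(1,1,2,3) f f b] by (simp add: set_eq_subset ball_conj_distrib)
qed

text \<open>A Yoneda argument: the arrow witnessing each clause is what membership gives at a
  universal element, namely the identity of \<open>X\<close> for reflexivity, the identity of
  \<open>R\<close> for symmetry, and the projections of a weak pullback for transitivity.
  Conversely, the witness is precomposed with an arbitrary element.\<close>

lemma pseudo_equivalence_relation_iff:
  assumes ob: "X \<in> Ob C" "R \<in> Ob C" and r: "r\<^sub>1 \<in> Hom A R X" "r\<^sub>2 \<in> Hom A R X"
  shows "pseudo_equivalence_relation C X R r\<^sub>1 r\<^sub>2 \<longleftrightarrow>
    (\<forall>P\<in>Ob C. equivalence_on (Hom A P X) (points A P (r\<^sub>1, r\<^sub>2)))"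
proof -
  have rC: "r\<^sub>1 \<in> Hom C R X" "r\<^sub>2 \<in> Hom C R X" using ob r Hom_C_iff by auto
  have iX: "Ide A X \<in> Hom A X X" and iR: "Ide A R \<in> Hom A R R" using ob Ob_C ide_hom by auto
  note pts = points_iff[OF r(1)]
  have "pseudo_reflexive C X R r\<^sub>1 r\<^sub>2 \<longleftrightarrow> (Ide A X, Ide A X) \<in> points A X (r\<^sub>1, r\<^sub>2)"
    unfolding pseudo_reflexive_def pts Ide_C[OF ob(1)]
    using cmp_C[OF _ rC(1), of _ X] cmp_C[OF _ rC(2), of _ X] Hom_C_iff ob by metis
  also have "\<dots> \<longleftrightarrow> (\<forall>P\<in>Ob C. Id_on (Hom A P X) \<subseteq> points A P (r\<^sub>1, r\<^sub>2))"
  proof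
    assume "(Ide A X, Ide A X) \<in> points A X (r\<^sub>1, r\<^sub>2)"
    then obtain \<delta> where d: "\<delta> \<in> Hom A X R" "r\<^sub>1 \<cdot> \<delta> = Ide A X" "r\<^sub>2 \<cdot> \<delta> = Ide A X" unfolding pts by metis
    show "\<forall>P\<in>Ob C. Id_on (Hom A P X) \<subseteq> points A P (r\<^sub>1, r\<^sub>2)"
    proof (intro ballI subrelI)
      fix P x y assume "(x, y) \<in> Id_on (Hom A P X)"
      then have x: "x \<in> Hom A P X" "y = x" by auto
      have "x = r\<^sub>1 \<cdot> (\<delta> \<cdot> x)" "x = r\<^sub>2 \<cdot> (\<delta> \<cdot> x)"
        using assoc[OF x(1) d(1) r(1)] assoc[OF x(1) d(1) r(2)] d ide_left[OF x(1)] by auto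
      then show "(x, y) \<in> points A P (r\<^sub>1, r\<^sub>2)" unfolding pts using cmp_hom[OF x(1) d(1)] x(2) by blast
    qed
  next
    assume "\<forall>P\<in>Ob C. Id_on (Hom A P X) \<subseteq> points A P (r\<^sub>1, r\<^sub>2)"
    then show "(Ide A X, Ide A X) \<in> points A X (r\<^sub>1, r\<^sub>2)" using iX ob by blast
  qed
  finally have refl: "pseudo_reflexive C X R r\<^sub>1 r\<^sub>2 \<longleftrightarrow> (\<forall>P\<in>Ob C. Id_on (Hom A P X) \<subseteq> points A P (r\<^sub>1, r\<^sub>2))" .

  have "pseudo_symmetric C X R r\<^sub>1 r\<^sub>2 \<longleftrightarrow> (r\<^sub>2, r\<^sub>1) \<in> points A R (r\<^sub>1, r\<^sub>2)"
    unfolding pseudo_symmetric_def pts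
    using cmp_C[OF _ rC(1), of _ R] cmp_C[OF _ rC(2), of _ R] Hom_C_iff ob by metis
  also have "\<dots> \<longleftrightarrow> (\<forall>P\<in>Ob C. (points A P (r\<^sub>1, r\<^sub>2))\<inverse> \<subseteq> points A P (r\<^sub>1, r\<^sub>2))"
  proof
    assume "(r\<^sub>2, r\<^sub>1) \<in> points A R (r\<^sub>1, r\<^sub>2)"
    then obtain \<sigma> where d: "\<sigma> \<in> Hom A R R" "r\<^sub>1 \<cdot> \<sigma> = r\<^sub>2" "r\<^sub>2 \<cdot> \<sigma> = r\<^sub>1" unfolding pts by metis
    show "\<forall>P\<in>Ob C. (points A P (r\<^sub>1, r\<^sub>2))\<inverse> \<subseteq> points A P (r\<^sub>1, r\<^sub>2)"
    proof (intro ballI subrelI)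
      fix P y x assume "(y, x) \<in> (points A P (r\<^sub>1, r\<^sub>2))\<inverse>"
      then obtain a where a: "a \<in> Hom A P R" "x = r\<^sub>1 \<cdot> a" "y = r\<^sub>2 \<cdot> a" using pts by blast
      have "y = r\<^sub>1 \<cdot> (\<sigma> \<cdot> a)" "x = r\<^sub>2 \<cdot> (\<sigma> \<cdot> a)"
        using assoc[OF a(1) d(1) r(1)] assoc[OF a(1) d(1) r(2)] d a by auto
      then show "(y, x) \<in> points A P (r\<^sub>1, r\<^sub>2)" unfolding pts using cmp_hom[OF a(1) d(1)] by blast
    qed
  next
    assume *: "\<forall>P\<in>Ob C. (points A P (r\<^sub>1, r\<^sub>2))\<inverse> \<subseteq> points A P (r\<^sub>1, r\<^sub>2)"
    have "(r\<^sub>1, r\<^sub>2) \<in> points A R (r\<^sub>1, r\<^sub>2)" unfolding pts using iR ide_right r by metis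
    then show "(r\<^sub>2, r\<^sub>1) \<in> points A R (r\<^sub>1, r\<^sub>2)" using * ob by blast
  qed
  finally have sym: "pseudo_symmetric C X R r\<^sub>1 r\<^sub>2 \<longleftrightarrow>
    (\<forall>P\<in>Ob C. (points A P (r\<^sub>1, r\<^sub>2))\<inverse> \<subseteq> points A P (r\<^sub>1, r\<^sub>2))" .

  have trans: "pseudo_transitive C X R r\<^sub>1 r\<^sub>2 \<longleftrightarrow>
    (\<forall>P\<in>Ob C. points A P (r\<^sub>1, r\<^sub>2) O points A P (r\<^sub>1, r\<^sub>2) \<subseteq> points A P (r\<^sub>1, r\<^sub>2))"
  proof
    assume "pseudo_transitive C X R r\<^sub>1 r\<^sub>2"
    then obtain W p\<^sub>1 p\<^sub>2 t where W: "weak_pullback C r\<^sub>2 r\<^sub>1 W p\<^sub>1 p\<^sub>2" and tC: "t \<in> Hom C W R"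
      and "r\<^sub>1 \<cdot>\<^bsub>C\<^esub> t = r\<^sub>1 \<cdot>\<^bsub>C\<^esub> p\<^sub>1" "r\<^sub>2 \<cdot>\<^bsub>C\<^esub> t = r\<^sub>2 \<cdot>\<^bsub>C\<^esub> p\<^sub>2"
      unfolding pseudo_transitive_def by blast
    moreover have pC: "p\<^sub>1 \<in> Hom C W R" "p\<^sub>2 \<in> Hom C W R"
      using W rC unfolding weak_pullback_def by (auto simp: Hom_def)
    ultimately have t': "r\<^sub>1 \<cdot> t = r\<^sub>1 \<cdot> p\<^sub>1" "r\<^sub>2 \<cdot> t = r\<^sub>2 \<cdot> p\<^sub>2" using cmp_C rC by metis+
    have h: "W \<in> Ob C" "t \<in> Hom A W R" "p\<^sub>1 \<in> Hom A W R" "p\<^sub>2 \<in> Hom A W R" using tC pC Hom_C_iff by auto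
    note w = W[unfolded weak_pullback_iff[OF ob(2,2,1) h(1) r(2,1) h(3,4)]]
    show "\<forall>P\<in>Ob C. points A P (r\<^sub>1, r\<^sub>2) O points A P (r\<^sub>1, r\<^sub>2) \<subseteq> points A P (r\<^sub>1, r\<^sub>2)"
    proof (intro ballI subrelI)
      fix P x z assume P: "P \<in> Ob C" and "(x, z) \<in> points A P (r\<^sub>1, r\<^sub>2) O points A P (r\<^sub>1, r\<^sub>2)"
      then obtain a b where ab: "a \<in> Hom A P R" "b \<in> Hom A P R" "r\<^sub>2 \<cdot> a = r\<^sub>1 \<cdot> b" "x = r\<^sub>1 \<cdot> a" "z = r\<^sub>2 \<cdot> b"
        by (auto simp: pts)
      then obtain c where c: "c \<in> Hom A P W" "p\<^sub>1 \<cdot> c = a" "p\<^sub>2 \<cdot> c = b" using w P by blast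
      have "x = r\<^sub>1 \<cdot> (t \<cdot> c)" "z = r\<^sub>2 \<cdot> (t \<cdot> c)"
        using cmp_eq_extend[OF t'(1) h(2) r(1) h(3) r(1) c(1)] cmp_eq_extend[OF t'(2) h(2) r(2) h(4) r(2) c(1)]
          ab c by auto
      then show "(x, z) \<in> points A P (r\<^sub>1, r\<^sub>2)" unfolding pts using cmp_hom[OF c(1) h(2)] by blast
    qed
  next
    assume *: "\<forall>P\<in>Ob C. points A P (r\<^sub>1, r\<^sub>2) O points A P (r\<^sub>1, r\<^sub>2) \<subseteq> points A P (r\<^sub>1, r\<^sub>2)"
    obtain W p\<^sub>1 p\<^sub>2 where W: "W \<in> Ob C" "p\<^sub>1 \<in> Hom A W R" "p\<^sub>2 \<in> Hom A W R" "r\<^sub>2 \<cdot> p\<^sub>1 = r\<^sub>1 \<cdot> p\<^sub>2"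
      "\<forall>Z\<in>Ob C. \<forall>a\<in>Hom A Z R. \<forall>b\<in>Hom A Z R. r\<^sub>2 \<cdot> a = r\<^sub>1 \<cdot> b \<longrightarrow> (\<exists>c\<in>Hom A Z W. p\<^sub>1 \<cdot> c = a \<and> p\<^sub>2 \<cdot> c = b)"
      using ex_weak_pullback[OF r(2,1)] by metis
    have "(r\<^sub>1 \<cdot> p\<^sub>1, r\<^sub>2 \<cdot> p\<^sub>1) \<in> points A W (r\<^sub>1, r\<^sub>2)" "(r\<^sub>2 \<cdot> p\<^sub>1, r\<^sub>2 \<cdot> p\<^sub>2) \<in> points A W (r\<^sub>1, r\<^sub>2)"
      unfolding pts using W by auto
    then have "(r\<^sub>1 \<cdot> p\<^sub>1, r\<^sub>2 \<cdot> p\<^sub>2) \<in> points A W (r\<^sub>1, r\<^sub>2)" using * W(1) by blast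
    then obtain t where t: "t \<in> Hom A W R" "r\<^sub>1 \<cdot> t = r\<^sub>1 \<cdot> p\<^sub>1" "r\<^sub>2 \<cdot> t = r\<^sub>2 \<cdot> p\<^sub>2" unfolding pts by metis
    have hC: "t \<in> Hom C W R" "p\<^sub>1 \<in> Hom C W R" "p\<^sub>2 \<in> Hom C W R" using W(1-3) t(1) ob Hom_C_iff by auto
    have "weak_pullback C r\<^sub>2 r\<^sub>1 W p\<^sub>1 p\<^sub>2"
      using weak_pullback_iff[OF ob(2,2,1) W(1) r(2,1) W(2,3)] W(4,5) by blast
    then show "pseudo_transitive C X R r\<^sub>1 r\<^sub>2"
      unfolding pseudo_transitive_def
      using t(2,3) hC(1) cmp_C[OF hC(1) rC(1)] cmp_C[OF hC(1) rC(2)] cmp_C[OF hC(2) rC(1)] cmp_C[OF hC(3) rC(2)]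
      by metis
  qed
  show ?thesis
    unfolding pseudo_equivalence_relation_def pseudo_relation_def equivalence_on_def refl sym trans
    using rC points_subset[OF r] by blast
qed

section \<open>Weak Goursat categories\<close>

text \<open>Reflexivity survives because arrows from \<open>P\<close> to \<open>Y\<close> lift to
  \<open>X\<close>, and symmetry passes to any image. Transitivity can fail: consecutive pairs of
  the image come from pairs of points of \<open>R\<close> whose inner ends agree under
  \<open>f\<close> without being equal.\<close>

lemma image_equivalence_iff:
  assumes r: "r\<^sub>1 \<in> Hom A R X" "r\<^sub>2 \<in> Hom A R X" and f: "f \<in> Hom A X Y" "regular_epi A f"
    and P: "P \<in> Ob C" and E: "equivalence_on (Hom A P X) (points A P (r\<^sub>1, r\<^sub>2))"
  shows "equivalence_on (Hom A P Y) (points A P (f \<cdot> r\<^sub>1, f \<cdot> r\<^sub>2)) \<longleftrightarrow>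
    points A P (f \<cdot> r\<^sub>1, f \<cdot> r\<^sub>2) O points A P (f \<cdot> r\<^sub>1, f \<cdot> r\<^sub>2) \<subseteq> points A P (f \<cdot> r\<^sub>1, f \<cdot> r\<^sub>2)"
proof -
  note pts = points_cmp_iff[OF r f(1)]
  have "points A P (f \<cdot> r\<^sub>1, f \<cdot> r\<^sub>2) \<subseteq> Hom A P Y \<times> Hom A P Y"
    using points_subset[OF cmp_hom[OF r(1) f(1)] cmp_hom[OF r(2) f(1)]] .
  moreover have "(y, y) \<in> points A P (f \<cdot> r\<^sub>1, f \<cdot> r\<^sub>2)" if y: "y \<in> Hom A P Y" for y
  proof -
    obtain x where x: "x \<in> Hom A P X" "f \<cdot> x = y" using lift[OF P y f] .
    then have "(x, x) \<in> points A P (r\<^sub>1, r\<^sub>2)" using E unfolding equivalence_on_def by blast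
    then show ?thesis using pts x by blast
  qed
  moreover have "(points A P (f \<cdot> r\<^sub>1, f \<cdot> r\<^sub>2))\<inverse> \<subseteq> points A P (f \<cdot> r\<^sub>1, f \<cdot> r\<^sub>2)"
  proof (rule subrelI)
    fix v u assume "(v, u) \<in> (points A P (f \<cdot> r\<^sub>1, f \<cdot> r\<^sub>2))\<inverse>"
    then obtain x y where "(x, y) \<in> points A P (r\<^sub>1, r\<^sub>2)" "u = f \<cdot> x" "v = f \<cdot> y" using pts by blast
    then show "(v, u) \<in> points A P (f \<cdot> r\<^sub>1, f \<cdot> r\<^sub>2)" using pts E unfolding equivalence_on_def by blast
  qed
  ultimately show ?thesis unfolding equivalence_on_def by blast
qed

lemma weak_goursat_iff:
  "weak_goursat C A \<longleftrightarrow> (\<forall>X R r\<^sub>1 r\<^sub>2 Y f. X \<in> Ob C \<and> R \<in> Ob C \<and> Y \<in> Ob C \<and>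
     r\<^sub>1 \<in> Hom A R X \<and> r\<^sub>2 \<in> Hom A R X \<and> f \<in> Hom A X Y \<and> regular_epi A f \<and>
     (\<forall>P\<in>Ob C. equivalence_on (Hom A P X) (points A P (r\<^sub>1, r\<^sub>2))) \<longrightarrow>
     (\<forall>P\<in>Ob C. points A P (f \<cdot> r\<^sub>1, f \<cdot> r\<^sub>2) O points A P (f \<cdot> r\<^sub>1, f \<cdot> r\<^sub>2) \<subseteq> points A P (f \<cdot> r\<^sub>1, f \<cdot> r\<^sub>2)))"
  (is "_ \<longleftrightarrow> (\<forall>X R r\<^sub>1 r\<^sub>2 Y f. ?hyp X R r\<^sub>1 r\<^sub>2 Y f \<longrightarrow> ?trans f r\<^sub>1 r\<^sub>2)")
proof -
  have hyp: "pseudo_equivalence_relation C X R r\<^sub>1 r\<^sub>2 \<and> f \<in> Hom C X Y \<and> cover_regular_epi C A f \<longleftrightarrow>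
      ?hyp X R r\<^sub>1 r\<^sub>2 Y f" (is "?l \<longleftrightarrow> ?r") for X R r\<^sub>1 r\<^sub>2 Y f
  proof
    assume l: ?l
    then have "r\<^sub>1 \<in> Hom C R X" "r\<^sub>2 \<in> Hom C R X" "f \<in> Hom C X Y" "regular_epi A f"
      unfolding pseudo_equivalence_relation_def pseudo_relation_def cover_regular_epi_def by auto
    then show ?r using l pseudo_equivalence_relation_iff Hom_C_iff by auto
  next
    assume r: ?r
    then have "f \<in> Hom C X Y" using Hom_C_iff by blast
    moreover from this have "cover_regular_epi C A f"
      using r unfolding cover_regular_epi_def by (simp add: Hom_def)
    ultimately show ?l using r pseudo_equivalence_relation_iff by blast
  qed
  have concl: "pseudo_equivalence_relation C Y R (f \<cdot>\<^bsub>C\<^esub> r\<^sub>1) (f \<cdot>\<^bsub>C\<^esub> r\<^sub>2) \<longleftrightarrow> ?trans f r\<^sub>1 r\<^sub>2"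
    if h: "?hyp X R r\<^sub>1 r\<^sub>2 Y f" for X R r\<^sub>1 r\<^sub>2 Y f
  proof -
    have hC: "r\<^sub>1 \<in> Hom C R X" "r\<^sub>2 \<in> Hom C R X" "f \<in> Hom C X Y" using h Hom_C_iff by auto
    have "pseudo_equivalence_relation C Y R (f \<cdot> r\<^sub>1) (f \<cdot> r\<^sub>2) \<longleftrightarrow>
        (\<forall>P\<in>Ob C. equivalence_on (Hom A P Y) (points A P (f \<cdot> r\<^sub>1, f \<cdot> r\<^sub>2)))"
      using h pseudo_equivalence_relation_iff cmp_hom by blast
    also have "\<dots> \<longleftrightarrow> ?trans f r\<^sub>1 r\<^sub>2"
    proof (rule ball_cong[OF refl])
      fix P assume P: "P \<in> Ob C"
      show "equivalence_on (Hom A P Y) (points A P (f \<cdot> r\<^sub>1, f \<cdot> r\<^sub>2)) \<longleftrightarrow>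
        points A P (f \<cdot> r\<^sub>1, f \<cdot> r\<^sub>2) O points A P (f \<cdot> r\<^sub>1, f \<cdot> r\<^sub>2) \<subseteq> points A P (f \<cdot> r\<^sub>1, f \<cdot> r\<^sub>2)"
        by (rule image_equivalence_iff[OF _ _ _ _ P]) (use h P in auto)
    qed
    finally show ?thesis unfolding cmp_C[OF hC(1,3)] cmp_C[OF hC(2,3)] .
  qed
  show ?thesis
    unfolding weak_goursat_def hyp using weakly_lex_C
    by (simp only: simp_thms) (intro all_cong1 imp_cong refl, rule concl)
qed

section \<open>The Goursat property of \<open>A\<close> and the weak Goursat property of
  \<open>C\<close>\<close>

text \<open>The inverse image along \<open>h\<close> on both sides, taken one leg at a time:
  \<open>W\<close> matches \<open>h\<close> with the first leg, then \<open>Q\<close> matches the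
  second leg with \<open>h\<close>. As both steps are weak pullbacks, \<open>Q\<close> is described
  only through its points.\<close>

lemma ex_inverse_image:
  assumes r: "r\<^sub>1 \<in> Hom A R X" "r\<^sub>2 \<in> Hom A R X" and h: "h \<in> Hom A Z X"
  obtains Q q\<^sub>1 q\<^sub>2 where "Q \<in> Ob C" "q\<^sub>1 \<in> Hom A Q Z" "q\<^sub>2 \<in> Hom A Q Z"
    "\<And>P a b. P \<in> Ob C \<Longrightarrow> a \<in> Hom A P Z \<Longrightarrow> b \<in> Hom A P Z \<Longrightarrow>
      (a, b) \<in> points A P (q\<^sub>1, q\<^sub>2) \<longleftrightarrow> (h \<cdot> a, h \<cdot> b) \<in> points A P (r\<^sub>1, r\<^sub>2)"
proof -
  obtain W p q where W: "W \<in> Ob C" "p \<in> Hom A W Z" "q \<in> Hom A W R" "h \<cdot> p = r\<^sub>1 \<cdot> q"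
    "\<forall>P\<in>Ob C. \<forall>a\<in>Hom A P Z. \<forall>b\<in>Hom A P R. h \<cdot> a = r\<^sub>1 \<cdot> b \<longrightarrow> (\<exists>c\<in>Hom A P W. p \<cdot> c = a \<and> q \<cdot> c = b)"
    by (rule ex_weak_pullback[OF h r(1)])
  have r2q: "r\<^sub>2 \<cdot> q \<in> Hom A W X" using cmp_hom[OF W(3) r(2)] .
  obtain Q u v where Q: "Q \<in> Ob C" "u \<in> Hom A Q W" "v \<in> Hom A Q Z" "(r\<^sub>2 \<cdot> q) \<cdot> u = h \<cdot> v"
    "\<forall>P\<in>Ob C. \<forall>a\<in>Hom A P W. \<forall>b\<in>Hom A P Z. (r\<^sub>2 \<cdot> q) \<cdot> a = h \<cdot> b \<longrightarrow> (\<exists>c\<in>Hom A P Q. u \<cdot> c = a \<and> v \<cdot> c = b)"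
    by (rule ex_weak_pullback[OF r2q h])
  have pu: "p \<cdot> u \<in> Hom A Q Z" using cmp_hom[OF Q(2) W(2)] .
  have "(a, b) \<in> points A P (p \<cdot> u, v) \<longleftrightarrow> (h \<cdot> a, h \<cdot> b) \<in> points A P (r\<^sub>1, r\<^sub>2)"
    if P: "P \<in> Ob C" and ab: "a \<in> Hom A P Z" "b \<in> Hom A P Z" for P a b
  proof
    assume "(a, b) \<in> points A P (p \<cdot> u, v)"
    then obtain c where c: "c \<in> Hom A P Q" "a = (p \<cdot> u) \<cdot> c" "b = v \<cdot> c" using points_iff[OF pu] by blast
    have uc: "u \<cdot> c \<in> Hom A P W" using cmp_hom[OF c(1) Q(2)] .
    have "h \<cdot> a = r\<^sub>1 \<cdot> (q \<cdot> (u \<cdot> c))"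
      using cmp_eq_extend[OF W(4,2) h W(3) r(1) uc] c(2) assoc[OF c(1) Q(2) W(2)] by simp
    moreover have "h \<cdot> b = r\<^sub>2 \<cdot> (q \<cdot> (u \<cdot> c))"
      using cmp_eq_extend[OF Q(4,2) r2q Q(3) h c(1)] c(3) assoc[OF uc W(3) r(2)] by simp
    ultimately show "(h \<cdot> a, h \<cdot> b) \<in> points A P (r\<^sub>1, r\<^sub>2)" using points_iff[OF r(1)] cmp_hom[OF uc W(3)] by blast
  next
    assume "(h \<cdot> a, h \<cdot> b) \<in> points A P (r\<^sub>1, r\<^sub>2)"
    then obtain d where d: "d \<in> Hom A P R" "h \<cdot> a = r\<^sub>1 \<cdot> d" "h \<cdot> b = r\<^sub>2 \<cdot> d" using points_iff[OF r(1)] by blast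
    obtain w where w: "w \<in> Hom A P W" "p \<cdot> w = a" "q \<cdot> w = d" using W(5) P ab(1) d(1,2) by blast
    have "(r\<^sub>2 \<cdot> q) \<cdot> w = h \<cdot> b" using assoc[OF w(1) W(3) r(2)] w d by simp
    then obtain c where c: "c \<in> Hom A P Q" "u \<cdot> c = w" "v \<cdot> c = b" using Q(5) P ab(2) w(1) by blast
    have "a = (p \<cdot> u) \<cdot> c" using assoc[OF c(1) Q(2) W(2)] c w by simp
    then show "(a, b) \<in> points A P (p \<cdot> u, v)" using points_iff[OF pu] c by blast
  qed
  then show thesis using that[OF Q(1) pu Q(3)] by blast
qed

lemma goursat_imp_weak_goursat:
  assumes "goursat A"
  shows "weak_goursat C A"
  unfolding weak_goursat_iff
proof (intro allI impI ballI subrelI)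
  fix X R r\<^sub>1 r\<^sub>2 Y f P u w
  assume hyp: "X \<in> Ob C \<and> R \<in> Ob C \<and> Y \<in> Ob C \<and> r\<^sub>1 \<in> Hom A R X \<and> r\<^sub>2 \<in> Hom A R X \<and> f \<in> Hom A X Y \<and>
    regular_epi A f \<and> (\<forall>P\<in>Ob C. equivalence_on (Hom A P X) (points A P (r\<^sub>1, r\<^sub>2)))"
    and P: "P \<in> Ob C" and uw: "(u, w) \<in> points A P (f \<cdot> r\<^sub>1, f \<cdot> r\<^sub>2) O points A P (f \<cdot> r\<^sub>1, f \<cdot> r\<^sub>2)"
  have r: "r\<^sub>1 \<in> Hom A R X" "r\<^sub>2 \<in> Hom A R X" and f: "f \<in> Hom A X Y"
    and E: "\<forall>P\<in>Ob C. equivalence_on (Hom A P X) (points A P (r\<^sub>1, r\<^sub>2))" using hyp by auto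
  \<comment> \<open>\<open>goursat\<close> concerns relations of \<open>A\<close>, so the
    pseudo-relation is replaced by its image \<open>(t\<^sub>1, t\<^sub>2)\<close>, an equivalence
    relation with the same points over \<open>C\<close>.\<close>
  obtain I e t\<^sub>1 t\<^sub>2 where I: "e \<in> Hom A R I" "regular_epi A e" "t\<^sub>1 \<in> Hom A I X" "t\<^sub>2 \<in> Hom A I X"
      "t\<^sub>1 \<cdot> e = r\<^sub>1" "t\<^sub>2 \<cdot> e = r\<^sub>2" and T: "relation A X X (t\<^sub>1, t\<^sub>2)"
    using image_relation[OF r] by metis
  have T_pts: "points A P (t\<^sub>1, t\<^sub>2) = points A P (r\<^sub>1, r\<^sub>2)" if "P \<in> Ob C" for P
    using points_regular_epi[OF I(1-4) that] I(5,6) by simp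
  have T_eq: "equivalence_relation A X (t\<^sub>1, t\<^sub>2)" using equivalence_relation_iff[OF T] E T_pts by simp
  obtain K p q where K: "pullback A f f K p q" using ex_pullback[OF finite_limits f f] by blast
  note k = pullbackE[OF K f f]
  have K_rel: "relation A X X (p, q)"
  proof (rule jointly_monic_relation[OF finite_limits k(1,2)])
    fix W a b assume ab: "a \<in> Hom A W K" "b \<in> Hom A W K" "p \<cdot> a = p \<cdot> b" "q \<cdot> a = q \<cdot> b"
    have "\<exists>!c. c \<in> Hom A W K \<and> p \<cdot> c = p \<cdot> a \<and> q \<cdot> c = q \<cdot> a"
      using k(4)[OF cmp_hom[OF ab(1) k(1)] cmp_hom[OF ab(1) k(2)]] cmp_eq_extend[OF k(3,1) f k(2) f ab(1)] by blast
    then show "a = b" using ab by metis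
  qed
  have K_pts: "(x, y) \<in> points A P (p, q) \<longleftrightarrow> x \<in> Hom A P X \<and> y \<in> Hom A P X \<and> f \<cdot> x = f \<cdot> y" for x y P
  proof
    assume "(x, y) \<in> points A P (p, q)"
    then obtain c where c: "c \<in> Hom A P K" "x = p \<cdot> c" "y = q \<cdot> c" using points_iff[OF k(1)] by blast
    then show "x \<in> Hom A P X \<and> y \<in> Hom A P X \<and> f \<cdot> x = f \<cdot> y"
      using cmp_eq_extend[OF k(3,1) f k(2) f c(1)] cmp_hom[OF c(1) k(1)] cmp_hom[OF c(1) k(2)] by simp
  next
    assume "x \<in> Hom A P X \<and> y \<in> Hom A P X \<and> f \<cdot> x = f \<cdot> y"
    then obtain c where "c \<in> Hom A P K" "p \<cdot> c = x" "q \<cdot> c = y" using k(4) by blast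
    then show "(x, y) \<in> points A P (p, q)" using points_iff[OF k(1)] by blast
  qed
  have K_eq: "equivalence_relation A X (p, q)"
    unfolding equivalence_relation_iff[OF K_rel] equivalence_on_def using K_pts by auto
  have RKR: "points A P (r\<^sub>1, r\<^sub>2) O points A P (p, q) O points A P (r\<^sub>1, r\<^sub>2) =
      points A P (p, q) O points A P (r\<^sub>1, r\<^sub>2) O points A P (p, q)"
    using assms[unfolded goursat_iff] T_eq K_eq P T_pts by metis
  \<comment> \<open>The two consecutive pairs of the image are lifted to \<open>X\<close>; their
    inner ends \<open>x'\<close> and \<open>y'\<close> agree only under \<open>f\<close>, which puts
    \<open>(x, y)\<close> into \<open>R K R\<close>. Read in \<open>K R K\<close> instead, the outer
    ends are moved within their fibres of \<open>f\<close>, and one pair \<open>(a, b)\<close> of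
    \<open>R\<close> with the same image remains.\<close>
  obtain x x' y y' where xy: "(x, x') \<in> points A P (r\<^sub>1, r\<^sub>2)" "(y', y) \<in> points A P (r\<^sub>1, r\<^sub>2)" "f \<cdot> x' = f \<cdot> y'"
    "u = f \<cdot> x" "w = f \<cdot> y"
    using uw by (auto simp: points_cmp_iff[OF r f])
  have "(x', y') \<in> points A P (p, q)" using K_pts xy points_subset[OF r] by blast
  then have "(x, y) \<in> points A P (p, q) O points A P (r\<^sub>1, r\<^sub>2) O points A P (p, q)" using xy RKR by blast
  then obtain a b where "(a, b) \<in> points A P (r\<^sub>1, r\<^sub>2)" "f \<cdot> x = f \<cdot> a" "f \<cdot> b = f \<cdot> y" using K_pts by blast
  then show "(u, w) \<in> points A P (f \<cdot> r\<^sub>1, f \<cdot> r\<^sub>2)" using points_cmp_iff[OF r f] xy by metis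
qed

text \<open>Over a cover \<open>e : X\<^sub>0 \<rightarrow> X\<close>, the composite \<open>S R S\<close> becomes the image along the split epimorphism
  \<open>s\<^sub>2\<close> of the inverse image of \<open>R\<close> along \<open>s\<^sub>1\<close>.  It is therefore transitive, and as it contains
  \<open>R\<close> and \<open>S\<close> it contains \<open>R S R\<close>.\<close>

lemma weak_goursat_imp_comp_subset:
  assumes wg: "weak_goursat C A" and R: "equivalence_relation A X R" and S: "equivalence_relation A X S"
    and P: "P \<in> Ob C"
  shows "points A P R O points A P S O points A P R \<subseteq> points A P S O points A P R O points A P S"
proof (rule subrelI)
  obtain r\<^sub>1 r\<^sub>2 s\<^sub>1 s\<^sub>2 where eqs: "R = (r\<^sub>1, r\<^sub>2)" "S = (s\<^sub>1, s\<^sub>2)" by (cases R, cases S)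
  have rel: "relation A X X (r\<^sub>1, r\<^sub>2)" "relation A X X (s\<^sub>1, s\<^sub>2)"
    using R S unfolding equivalence_relation_def eqs by auto
  obtain R' where r: "r\<^sub>1 \<in> Hom A R' X" "r\<^sub>2 \<in> Hom A R' X" by (rule relation_hom[OF rel(1)])
  obtain S' where s: "s\<^sub>1 \<in> Hom A S' X" "s\<^sub>2 \<in> Hom A S' X" by (rule relation_hom[OF rel(2)])
  have ER: "equivalence_on (Hom A P X) (points A P (r\<^sub>1, r\<^sub>2))"
    and ES: "equivalence_on (Hom A P X) (points A P (s\<^sub>1, s\<^sub>2))" if "P \<in> Ob C" for P
    using R S equivalence_relation_iff[OF rel(1)] equivalence_relation_iff[OF rel(2)] that unfolding eqs by auto
  obtain X\<^sub>0 e where e: "X\<^sub>0 \<in> Ob C" "e \<in> Hom A X\<^sub>0 X" "regular_epi A e" using cover hom_ob(2)[OF r(1)] by blast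
  \<comment> \<open>An element of \<open>T\<close> amounts to two elements of
    \<open>X\<^sub>0\<close> whose images under \<open>e\<close> are related by \<open>S\<close>;
    \<open>Q\<close> below relates two elements of \<open>T\<close> when their first components have
    images under \<open>e\<close> related by \<open>R\<close>.\<close>
  obtain T t\<^sub>1 t\<^sub>2 where T: "T \<in> Ob C" "t\<^sub>1 \<in> Hom A T X\<^sub>0" "t\<^sub>2 \<in> Hom A T X\<^sub>0"
    and T_pts: "\<And>P a b. P \<in> Ob C \<Longrightarrow> a \<in> Hom A P X\<^sub>0 \<Longrightarrow> b \<in> Hom A P X\<^sub>0 \<Longrightarrow>
      (a, b) \<in> points A P (t\<^sub>1, t\<^sub>2) \<longleftrightarrow> (e \<cdot> a, e \<cdot> b) \<in> points A P (s\<^sub>1, s\<^sub>2)"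
    using ex_inverse_image[OF s e(2)] by metis
  have et: "e \<cdot> t\<^sub>1 \<in> Hom A T X" using cmp_hom[OF T(2) e(2)] .
  obtain Q q\<^sub>1 q\<^sub>2 where Q: "Q \<in> Ob C" "q\<^sub>1 \<in> Hom A Q T" "q\<^sub>2 \<in> Hom A Q T"
    and Q_pts': "\<And>P a b. P \<in> Ob C \<Longrightarrow> a \<in> Hom A P T \<Longrightarrow> b \<in> Hom A P T \<Longrightarrow>
      (a, b) \<in> points A P (q\<^sub>1, q\<^sub>2) \<longleftrightarrow> ((e \<cdot> t\<^sub>1) \<cdot> a, (e \<cdot> t\<^sub>1) \<cdot> b) \<in> points A P (r\<^sub>1, r\<^sub>2)"
    using ex_inverse_image[OF r et] by metis
  have Q_pts: "(a, b) \<in> points A P (q\<^sub>1, q\<^sub>2) \<longleftrightarrow> (e \<cdot> (t\<^sub>1 \<cdot> a), e \<cdot> (t\<^sub>1 \<cdot> b)) \<in> points A P (r\<^sub>1, r\<^sub>2)"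
    if "P \<in> Ob C" "a \<in> Hom A P T" "b \<in> Hom A P T" for P a b
    using Q_pts'[OF that] assoc[OF that(2) T(2) e(2)] assoc[OF that(3) T(2) e(2)] by simp
  have hT: "t\<^sub>1 \<cdot> a \<in> Hom A P X\<^sub>0" "e \<cdot> (t\<^sub>1 \<cdot> a) \<in> Hom A P X" if "a \<in> Hom A P T" for P a
    using cmp_hom[OF that T(2)] cmp_hom[OF _ e(2)] by auto
  have Q_sub: "points A P (q\<^sub>1, q\<^sub>2) \<subseteq> Hom A P T \<times> Hom A P T" for P using points_subset[OF Q(2,3)] .
  have "equivalence_on (Hom A P T) (points A P (q\<^sub>1, q\<^sub>2))" if P: "P \<in> Ob C" for P
    unfolding equivalence_on_def
  proof (intro conjI subrelI)
    show "(a, b) \<in> Hom A P T \<times> Hom A P T" if "(a, b) \<in> points A P (q\<^sub>1, q\<^sub>2)" for a b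
      using that Q_sub by blast
    show "(a, b) \<in> points A P (q\<^sub>1, q\<^sub>2)" if "(a, b) \<in> Id_on (Hom A P T)" for a b
      using that Q_pts[OF P] hT ER[OF P] unfolding equivalence_on_def by blast
    show "(a, b) \<in> points A P (q\<^sub>1, q\<^sub>2)" if "(a, b) \<in> (points A P (q\<^sub>1, q\<^sub>2))\<inverse>" for a b
      using that Q_pts[OF P] Q_sub ER[OF P] unfolding equivalence_on_def by blast
    show "(a, c) \<in> points A P (q\<^sub>1, q\<^sub>2)" if ac: "(a, c) \<in> points A P (q\<^sub>1, q\<^sub>2) O points A P (q\<^sub>1, q\<^sub>2)" for a c
    proof -
      obtain b where ab: "(a, b) \<in> points A P (q\<^sub>1, q\<^sub>2)" "(b, c) \<in> points A P (q\<^sub>1, q\<^sub>2)" using ac by blast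
      then have h: "a \<in> Hom A P T" "b \<in> Hom A P T" "c \<in> Hom A P T" using Q_sub by auto
      show ?thesis
        using Q_pts[OF P h(1,2)] Q_pts[OF P h(2,3)] Q_pts[OF P h(1,3)] ab ER[OF P] unfolding equivalence_on_def by blast
    qed
  qed
  \<comment> \<open>Reflexivity of \<open>S\<close>, tested at the identity of
    \<open>X\<^sub>0\<close>, gives a diagonal that splits \<open>t\<^sub>2\<close>.\<close>
  moreover have "regular_epi A t\<^sub>2"
  proof -
    have iX: "Ide A X\<^sub>0 \<in> Hom A X\<^sub>0 X\<^sub>0" using e(1) Ob_C ide_hom by blast
    have "(Ide A X\<^sub>0, Ide A X\<^sub>0) \<in> points A X\<^sub>0 (t\<^sub>1, t\<^sub>2)"
      using T_pts[OF e(1) iX iX] ES[OF e(1)] cmp_hom[OF iX e(2)] unfolding equivalence_on_def by blast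
    then obtain k where "k \<in> Hom A X\<^sub>0 T" "t\<^sub>2 \<cdot> k = Ide A X\<^sub>0" using points_iff[OF T(2)] by metis
    then show ?thesis using split_epi_regular[OF T(3)] by blast
  qed
  ultimately have trans: "points A P (t\<^sub>2 \<cdot> q\<^sub>1, t\<^sub>2 \<cdot> q\<^sub>2) O points A P (t\<^sub>2 \<cdot> q\<^sub>1, t\<^sub>2 \<cdot> q\<^sub>2) \<subseteq>
      points A P (t\<^sub>2 \<cdot> q\<^sub>1, t\<^sub>2 \<cdot> q\<^sub>2)"
    using wg[unfolded weak_goursat_iff] T Q e(1) P by blast
  \<comment> \<open>From \<open>a\<close> back to the first component of an element of
    \<open>T\<close>, across by \<open>R\<close>, and forth to \<open>b\<close>: this is
    \<open>S\<close>, then \<open>R\<close>, then \<open>S\<close>, the first \<open>S\<close> being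
    reversed by symmetry.\<close>
  have img: "(a, b) \<in> points A P (t\<^sub>2 \<cdot> q\<^sub>1, t\<^sub>2 \<cdot> q\<^sub>2) \<longleftrightarrow> (e \<cdot> a, e \<cdot> b) \<in>
      points A P S O points A P R O points A P S" if ab: "a \<in> Hom A P X\<^sub>0" "b \<in> Hom A P X\<^sub>0" for a b
  proof
    assume "(a, b) \<in> points A P (t\<^sub>2 \<cdot> q\<^sub>1, t\<^sub>2 \<cdot> q\<^sub>2)"
    then obtain c d where cd: "(c, d) \<in> points A P (q\<^sub>1, q\<^sub>2)" "a = t\<^sub>2 \<cdot> c" "b = t\<^sub>2 \<cdot> d"
      using points_cmp_iff[OF Q(2,3) T(3)] by blast
    have h: "c \<in> Hom A P T" "d \<in> Hom A P T" using cd Q_sub by auto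
    have "(t\<^sub>1 \<cdot> c, a) \<in> points A P (t\<^sub>1, t\<^sub>2)" "(t\<^sub>1 \<cdot> d, b) \<in> points A P (t\<^sub>1, t\<^sub>2)"
      using points_iff[OF T(2)] h cd by blast+
    then have "(e \<cdot> (t\<^sub>1 \<cdot> c), e \<cdot> a) \<in> points A P S" "(e \<cdot> (t\<^sub>1 \<cdot> d), e \<cdot> b) \<in> points A P S"
      using T_pts[OF P hT(1)] h ab unfolding eqs by blast+
    moreover have "(e \<cdot> (t\<^sub>1 \<cdot> c), e \<cdot> (t\<^sub>1 \<cdot> d)) \<in> points A P R" using Q_pts[OF P h] cd unfolding eqs by blast
    ultimately show "(e \<cdot> a, e \<cdot> b) \<in> points A P S O points A P R O points A P S"
      using ES[OF P] unfolding equivalence_on_def eqs by blast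
  next
    assume "(e \<cdot> a, e \<cdot> b) \<in> points A P S O points A P R O points A P S"
    then obtain x y where xy: "(e \<cdot> a, x) \<in> points A P (s\<^sub>1, s\<^sub>2)" "(x, y) \<in> points A P (r\<^sub>1, r\<^sub>2)"
      "(y, e \<cdot> b) \<in> points A P (s\<^sub>1, s\<^sub>2)"
      unfolding eqs by blast
    then have h: "x \<in> Hom A P X" "y \<in> Hom A P X" using points_subset[OF r] by auto
    obtain x' where x': "x' \<in> Hom A P X\<^sub>0" "e \<cdot> x' = x" using lift[OF P h(1) e(2,3)] .
    obtain y' where y': "y' \<in> Hom A P X\<^sub>0" "e \<cdot> y' = y" using lift[OF P h(2) e(2,3)] .
    have "(x', a) \<in> points A P (t\<^sub>1, t\<^sub>2)" "(y', b) \<in> points A P (t\<^sub>1, t\<^sub>2)"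
      using T_pts[OF P] x' y' ab xy ES[OF P] unfolding equivalence_on_def by blast+
    then obtain c d where cd: "c \<in> Hom A P T" "x' = t\<^sub>1 \<cdot> c" "a = t\<^sub>2 \<cdot> c"
      "d \<in> Hom A P T" "y' = t\<^sub>1 \<cdot> d" "b = t\<^sub>2 \<cdot> d"
      using points_iff[OF T(2)] by metis
    then have "(c, d) \<in> points A P (q\<^sub>1, q\<^sub>2)" using Q_pts[OF P cd(1,4)] xy x' y' by simp
    then show "(a, b) \<in> points A P (t\<^sub>2 \<cdot> q\<^sub>1, t\<^sub>2 \<cdot> q\<^sub>2)" using points_cmp_iff[OF Q(2,3) T(3)] cd by blast
  qed
  fix x y assume "(x, y) \<in> points A P R O points A P S O points A P R"
  then obtain z w where zw: "(x, z) \<in> points A P R" "(z, w) \<in> points A P S" "(w, y) \<in> points A P R" by blast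
  then have h: "x \<in> Hom A P X" "z \<in> Hom A P X" "w \<in> Hom A P X" "y \<in> Hom A P X"
    using points_subset[OF r] unfolding eqs by auto
  obtain x' where x': "x' \<in> Hom A P X\<^sub>0" "e \<cdot> x' = x" using lift[OF P h(1) e(2,3)] .
  obtain z' where z': "z' \<in> Hom A P X\<^sub>0" "e \<cdot> z' = z" using lift[OF P h(2) e(2,3)] .
  obtain w' where w': "w' \<in> Hom A P X\<^sub>0" "e \<cdot> w' = w" using lift[OF P h(3) e(2,3)] .
  obtain y' where y': "y' \<in> Hom A P X\<^sub>0" "e \<cdot> y' = y" using lift[OF P h(4) e(2,3)] .
  have refl: "(v, v) \<in> points A P R" "(v, v) \<in> points A P S" if "v \<in> Hom A P X" for v
    using that ER[OF P] ES[OF P] unfolding equivalence_on_def eqs by auto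
  \<comment> \<open>Each of the three steps lies in \<open>S R S\<close> by padding with
    reflexivity: the \<open>R\<close> steps by \<open>S\<close> on both sides, the \<open>S\<close>
    step by \<open>R\<close> and \<open>S\<close>. Transitivity of the image then joins
    them.\<close>
  have "(x', z') \<in> points A P (t\<^sub>2 \<cdot> q\<^sub>1, t\<^sub>2 \<cdot> q\<^sub>2)" "(w', y') \<in> points A P (t\<^sub>2 \<cdot> q\<^sub>1, t\<^sub>2 \<cdot> q\<^sub>2)"
    "(z', w') \<in> points A P (t\<^sub>2 \<cdot> q\<^sub>1, t\<^sub>2 \<cdot> q\<^sub>2)"
    using img x' y' z' w' zw refl h by blast+
  then have "(x', y') \<in> points A P (t\<^sub>2 \<cdot> q\<^sub>1, t\<^sub>2 \<cdot> q\<^sub>2)" using trans by blast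
  then show "(x, y) \<in> points A P S O points A P R O points A P S" using img x' y' by simp
qed

text \<open>Exchanging \<open>R\<close> and \<open>S\<close> turns the one inclusion into its
  reverse.\<close>

lemma weak_goursat_imp_goursat: "weak_goursat C A \<Longrightarrow> goursat A"
  unfolding goursat_iff by (intro allI impI ballI equalityI weak_goursat_imp_comp_subset) auto

section \<open>The weak Goursat property and weak kernel pairs\<close>

lemma weak_goursat_imp_weak_kernel_pair:
  assumes wg: "weak_goursat C A"
    and ob: "X \<in> Ob C" "U \<in> Ob C" "Y \<in> Ob C" "W \<in> Ob C" "F \<in> Ob C" "G \<in> Ob C"
    and \<alpha>: "\<alpha> \<in> Hom A X U" "regular_epi A \<alpha>" and \<beta>: "\<beta> \<in> Hom A Y W"
    and f: "f \<in> Hom A X Y" and s: "s \<in> Hom A Y X" and g: "g \<in> Hom A U W" and t: "t \<in> Hom A W U"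
    and b: "\<beta>\<^sub>1 \<in> Hom A F X" "\<beta>\<^sub>2 \<in> Hom A F X" and \<rho>: "\<rho>\<^sub>1 \<in> Hom A G U" "\<rho>\<^sub>2 \<in> Hom A G U"
    and l: "l \<in> Hom A F G" "regular_epi A l"
    and eqs: "f \<cdot> s = Ide A Y" "g \<cdot> \<alpha> = \<beta> \<cdot> f" "\<alpha> \<cdot> s = t \<cdot> \<beta>"
      "\<alpha> \<cdot> \<beta>\<^sub>1 = \<rho>\<^sub>1 \<cdot> l" "\<alpha> \<cdot> \<beta>\<^sub>2 = \<rho>\<^sub>2 \<cdot> l"
    and wk: "weak_kernel_pair C f F \<beta>\<^sub>1 \<beta>\<^sub>2"
  shows "weak_kernel_pair C g G \<rho>\<^sub>1 \<rho>\<^sub>2"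
  unfolding weak_kernel_pair_iff[OF ob(2,4,6) g \<rho>]
proof
  fix P assume P: "P \<in> Ob C"
  have F_pts: "(x, y) \<in> points A P (\<beta>\<^sub>1, \<beta>\<^sub>2) \<longleftrightarrow> x \<in> Hom A P X \<and> y \<in> Hom A P X \<and> f \<cdot> x = f \<cdot> y"
    if "P \<in> Ob C" for P x y
    using wk[unfolded weak_kernel_pair_iff[OF ob(1,3,5) f b]] that by auto
  \<comment> \<open>Over \<open>C\<close> the weak kernel pair of \<open>f\<close> has the points of
    the kernel relation of \<open>f\<close>, so the weak Goursat property along
    \<open>\<alpha>\<close> applies to it.\<close>
  have "\<forall>P\<in>Ob C. equivalence_on (Hom A P X) (points A P (\<beta>\<^sub>1, \<beta>\<^sub>2))"
    unfolding equivalence_on_def by (auto simp: F_pts)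
  then have trans: "points A P (\<alpha> \<cdot> \<beta>\<^sub>1, \<alpha> \<cdot> \<beta>\<^sub>2) O points A P (\<alpha> \<cdot> \<beta>\<^sub>1, \<alpha> \<cdot> \<beta>\<^sub>2) \<subseteq> points A P (\<alpha> \<cdot> \<beta>\<^sub>1, \<alpha> \<cdot> \<beta>\<^sub>2)"
    using wg[unfolded weak_goursat_iff] ob b \<alpha> P by blast
  have img: "(u, v) \<in> points A P (\<alpha> \<cdot> \<beta>\<^sub>1, \<alpha> \<cdot> \<beta>\<^sub>2) \<longleftrightarrow>
      (\<exists>x\<in>Hom A P X. \<exists>y\<in>Hom A P X. f \<cdot> x = f \<cdot> y \<and> u = \<alpha> \<cdot> x \<and> v = \<alpha> \<cdot> y)" for u v
    unfolding points_cmp_iff[OF b \<alpha>(1)] F_pts[OF P] by blast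
  have "points A P (\<alpha> \<cdot> \<beta>\<^sub>1, \<alpha> \<cdot> \<beta>\<^sub>2) = {(u, v) \<in> Hom A P U \<times> Hom A P U. g \<cdot> u = g \<cdot> v}"
  proof (intro equalityI subrelI)
    fix u v assume "(u, v) \<in> points A P (\<alpha> \<cdot> \<beta>\<^sub>1, \<alpha> \<cdot> \<beta>\<^sub>2)"
    then obtain x y where xy: "x \<in> Hom A P X" "y \<in> Hom A P X" "f \<cdot> x = f \<cdot> y" "u = \<alpha> \<cdot> x" "v = \<alpha> \<cdot> y"
      using img by blast
    have "g \<cdot> u = g \<cdot> v"
      using cmp_eq_extend[OF eqs(2) \<alpha>(1) g f \<beta> xy(1)] cmp_eq_extend[OF eqs(2) \<alpha>(1) g f \<beta> xy(2)] xy by simp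
    then show "(u, v) \<in> {(u, v) \<in> Hom A P U \<times> Hom A P U. g \<cdot> u = g \<cdot> v}"
      using xy cmp_hom[OF _ \<alpha>(1)] by blast
  next
    fix u v assume "(u, v) \<in> {(u, v) \<in> Hom A P U \<times> Hom A P U. g \<cdot> u = g \<cdot> v}"
    then have uv: "u \<in> Hom A P U" "v \<in> Hom A P U" "g \<cdot> u = g \<cdot> v" by auto
    obtain x where x: "x \<in> Hom A P X" "\<alpha> \<cdot> x = u" using lift[OF P uv(1) \<alpha>] .
    obtain y where y: "y \<in> Hom A P X" "\<alpha> \<cdot> y = v" using lift[OF P uv(2) \<alpha>] .
    \<comment> \<open>\<open>s \<cdot> (f \<cdot> z)\<close> lies in the same fibre of
      \<open>f\<close> as \<open>z\<close>, and its image under \<open>\<alpha>\<close> depends only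
      on \<open>g \<cdot> (\<alpha> \<cdot> z)\<close>. This image is the common term through which
      \<open>u\<close> and \<open>v\<close> are linked.\<close>
    have retract: "s \<cdot> (f \<cdot> z) \<in> Hom A P X" "f \<cdot> (s \<cdot> (f \<cdot> z)) = f \<cdot> z"
        "\<alpha> \<cdot> (s \<cdot> (f \<cdot> z)) = t \<cdot> (g \<cdot> (\<alpha> \<cdot> z))" if z: "z \<in> Hom A P X" for z
    proof -
      have fz: "f \<cdot> z \<in> Hom A P Y" using cmp_hom[OF z f] .
      show "s \<cdot> (f \<cdot> z) \<in> Hom A P X" using cmp_hom[OF fz s] .
      show "f \<cdot> (s \<cdot> (f \<cdot> z)) = f \<cdot> z" using cmp_eq_extend1[OF eqs(1) s f fz] ide_left[OF fz] by simp
      show "\<alpha> \<cdot> (s \<cdot> (f \<cdot> z)) = t \<cdot> (g \<cdot> (\<alpha> \<cdot> z))"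
        using cmp_eq_extend[OF eqs(3) s \<alpha>(1) \<beta> t fz] cmp_eq_extend[OF eqs(2) \<alpha>(1) g f \<beta> z] by simp
    qed
    have "(u, t \<cdot> (g \<cdot> u)) \<in> points A P (\<alpha> \<cdot> \<beta>\<^sub>1, \<alpha> \<cdot> \<beta>\<^sub>2)"
      unfolding img using retract[OF x(1)] x by metis
    moreover have "(t \<cdot> (g \<cdot> v), v) \<in> points A P (\<alpha> \<cdot> \<beta>\<^sub>1, \<alpha> \<cdot> \<beta>\<^sub>2)"
      unfolding img using retract[OF y(1)] y by metis
    ultimately show "(u, v) \<in> points A P (\<alpha> \<cdot> \<beta>\<^sub>1, \<alpha> \<cdot> \<beta>\<^sub>2)" using trans uv(3) by auto
  qed
  \<comment> \<open>Since \<open>l\<close> is a regular epimorphism, the pair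
    \<open>\<rho>\<^sub>1, \<rho>\<^sub>2\<close> has the same points as its composite with
    \<open>l\<close>, which is the image of the weak kernel pair of \<open>f\<close> along
    \<open>\<alpha>\<close>.\<close>
  then show "points A P (\<rho>\<^sub>1, \<rho>\<^sub>2) = {(u, v) \<in> Hom A P U \<times> Hom A P U. g \<cdot> u = g \<cdot> v}"
    unfolding eqs(4,5) points_regular_epi[OF l \<rho> P] .
qed

text \<open>Given a pseudo-equivalence relation \<open>r\<^sub>1, r\<^sub>2 : R \<rightarrow> X\<close> and a split epimorphism \<open>h : X \<rightarrow> Y\<close>, let
  \<open>K\<close> be the weak kernel pair of \<open>(h r\<^sub>1, h r\<^sub>2)\<close>.  It has a split epimorphism \<open>r\<^sub>1 k\<^sub>1\<close> to \<open>X\<close>, lying over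
  the split epimorphism \<open>h r\<^sub>1 : R \<rightarrow> Y\<close> by means of \<open>k\<^sub>2\<close>.  That kernel pairs are preserved from the
  former to the latter says that two elements of the image of \<open>R\<close> along \<open>h\<close> with the same source can be represented by two
  elements of \<open>R\<close> with the same source.\<close>

lemma weak_kernel_pair_imp_weak_goursat:
  assumes kp: "\<And>X U Y W F \<alpha> \<beta> f s g t \<beta>\<^sub>1 \<beta>\<^sub>2.
      X \<in> Ob C \<Longrightarrow> U \<in> Ob C \<Longrightarrow> Y \<in> Ob C \<Longrightarrow> W \<in> Ob C \<Longrightarrow> F \<in> Ob C \<Longrightarrow>
      \<alpha> \<in> Hom A X U \<Longrightarrow> regular_epi A \<alpha> \<Longrightarrow> \<beta> \<in> Hom A Y W \<Longrightarrow> regular_epi A \<beta> \<Longrightarrow>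
      f \<in> Hom A X Y \<Longrightarrow> s \<in> Hom A Y X \<Longrightarrow> g \<in> Hom A U W \<Longrightarrow> t \<in> Hom A W U \<Longrightarrow>
      \<beta>\<^sub>1 \<in> Hom A F X \<Longrightarrow> \<beta>\<^sub>2 \<in> Hom A F X \<Longrightarrow>
      f \<cdot> s = Ide A Y \<Longrightarrow> g \<cdot> t = Ide A W \<Longrightarrow> g \<cdot> \<alpha> = \<beta> \<cdot> f \<Longrightarrow> \<alpha> \<cdot> s = t \<cdot> \<beta> \<Longrightarrow>
      weak_kernel_pair C f F \<beta>\<^sub>1 \<beta>\<^sub>2 \<Longrightarrow> weak_kernel_pair C g F (\<alpha> \<cdot> \<beta>\<^sub>1) (\<alpha> \<cdot> \<beta>\<^sub>2)"
  shows "weak_goursat C A"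
  unfolding weak_goursat_iff
proof (intro allI impI ballI subrelI)
  fix X R r\<^sub>1 r\<^sub>2 Y h P u w
  assume hyp: "X \<in> Ob C \<and> R \<in> Ob C \<and> Y \<in> Ob C \<and> r\<^sub>1 \<in> Hom A R X \<and> r\<^sub>2 \<in> Hom A R X \<and> h \<in> Hom A X Y \<and>
    regular_epi A h \<and> (\<forall>P\<in>Ob C. equivalence_on (Hom A P X) (points A P (r\<^sub>1, r\<^sub>2)))"
    and P: "P \<in> Ob C" and uw: "(u, w) \<in> points A P (h \<cdot> r\<^sub>1, h \<cdot> r\<^sub>2) O points A P (h \<cdot> r\<^sub>1, h \<cdot> r\<^sub>2)"
  have ob: "X \<in> Ob C" "R \<in> Ob C" "Y \<in> Ob C"
    and r: "r\<^sub>1 \<in> Hom A R X" "r\<^sub>2 \<in> Hom A R X" and h: "h \<in> Hom A X Y" "regular_epi A h"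
    and E: "\<And>P. P \<in> Ob C \<Longrightarrow> equivalence_on (Hom A P X) (points A P (r\<^sub>1, r\<^sub>2))" using hyp by auto
  have id: "Ide A X \<in> Hom A X X" "Ide A Y \<in> Hom A Y Y" "Ide A R \<in> Hom A R R"
    using ob Ob_C ide_hom by auto
  have hr: "h \<cdot> r\<^sub>1 \<in> Hom A R Y" "h \<cdot> r\<^sub>2 \<in> Hom A R Y" using r cmp_hom[OF _ h(1)] by auto

  have "(Ide A X, Ide A X) \<in> points A X (r\<^sub>1, r\<^sub>2)" using E[OF ob(1)] id unfolding equivalence_on_def by blast
  then obtain \<delta> where \<delta>: "\<delta> \<in> Hom A X R" "r\<^sub>1 \<cdot> \<delta> = Ide A X" "r\<^sub>2 \<cdot> \<delta> = Ide A X"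
    using points_iff[OF r(1)] by metis
  have \<delta>_cancel: "r\<^sub>1 \<cdot> (\<delta> \<cdot> x) = x" "r\<^sub>2 \<cdot> (\<delta> \<cdot> x) = x" if "x \<in> Hom A Z X" for x Z
    using cmp_eq_extend1[OF \<delta>(2,1) r(1) that] cmp_eq_extend1[OF \<delta>(3,1) r(2) that] ide_left[OF that] by auto
  obtain k where k: "k \<in> Hom A Y X" "h \<cdot> k = Ide A Y" using lift[OF ob(3) id(2) h] .

  obtain K k\<^sub>1 k\<^sub>2 where K: "K \<in> Ob C" "k\<^sub>1 \<in> Hom A K R" "k\<^sub>2 \<in> Hom A K R"
      "h \<cdot> (r\<^sub>1 \<cdot> k\<^sub>1) = h \<cdot> (r\<^sub>1 \<cdot> k\<^sub>2)" "h \<cdot> (r\<^sub>2 \<cdot> k\<^sub>1) = h \<cdot> (r\<^sub>2 \<cdot> k\<^sub>2)"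
    and K_lift: "\<And>Z a b. Z \<in> Ob C \<Longrightarrow> a \<in> Hom A Z R \<Longrightarrow> b \<in> Hom A Z R \<Longrightarrow> h \<cdot> (r\<^sub>1 \<cdot> a) = h \<cdot> (r\<^sub>1 \<cdot> b) \<Longrightarrow>
      h \<cdot> (r\<^sub>2 \<cdot> a) = h \<cdot> (r\<^sub>2 \<cdot> b) \<Longrightarrow> \<exists>c\<in>Hom A Z K. k\<^sub>1 \<cdot> c = a \<and> k\<^sub>2 \<cdot> c = b"
  proof -
    \<comment> \<open>The product Y \<times> Y is formed in \<open>A\<close> and may lie outside
      \<open>C\<close>; it serves to express the two equations on the ends as the single equation
      \<open>m \<cdot> a = m \<cdot> b\<close>.\<close>
    obtain V x y where V: "is_product A Y Y V x y" using ex_product[OF finite_limits] ob(3) Ob_C by blast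
    have xy: "x \<in> Hom A V Y" "y \<in> Hom A V Y" using V unfolding is_product_def by auto
    obtain m where m: "m \<in> Hom A R V" "x \<cdot> m = h \<cdot> r\<^sub>1" "y \<cdot> m = h \<cdot> r\<^sub>2"
      using V hr unfolding is_product_def by blast
    have m_iff: "m \<cdot> a = m \<cdot> b \<longleftrightarrow> h \<cdot> (r\<^sub>1 \<cdot> a) = h \<cdot> (r\<^sub>1 \<cdot> b) \<and> h \<cdot> (r\<^sub>2 \<cdot> a) = h \<cdot> (r\<^sub>2 \<cdot> b)"
      if ab: "a \<in> Hom A Z R" "b \<in> Hom A Z R" for Z a b
    proof -
      have eq: "x \<cdot> (m \<cdot> a) = h \<cdot> (r\<^sub>1 \<cdot> a)" "y \<cdot> (m \<cdot> a) = h \<cdot> (r\<^sub>2 \<cdot> a)" if "a \<in> Hom A Z R" for a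
        using cmp_eq_extend[OF m(2,1) xy(1) r(1) h(1) that] cmp_eq_extend[OF m(3,1) xy(2) r(2) h(1) that] by auto
      have ma: "m \<cdot> a \<in> Hom A Z V" "m \<cdot> b \<in> Hom A Z V" using cmp_hom[OF _ m(1)] ab by auto
      have "\<exists>!c. c \<in> Hom A Z V \<and> x \<cdot> c = x \<cdot> (m \<cdot> a) \<and> y \<cdot> c = y \<cdot> (m \<cdot> a)"
        using V cmp_hom[OF ma(1) xy(1)] cmp_hom[OF ma(1) xy(2)] unfolding is_product_def by blast
      then show ?thesis using eq[OF ab(1)] eq[OF ab(2)] ma by metis
    qed
    obtain K k\<^sub>1 k\<^sub>2 where "K \<in> Ob C" "k\<^sub>1 \<in> Hom A K R" "k\<^sub>2 \<in> Hom A K R" "m \<cdot> k\<^sub>1 = m \<cdot> k\<^sub>2"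
      "\<forall>Z\<in>Ob C. \<forall>a\<in>Hom A Z R. \<forall>b\<in>Hom A Z R. m \<cdot> a = m \<cdot> b \<longrightarrow> (\<exists>c\<in>Hom A Z K. k\<^sub>1 \<cdot> c = a \<and> k\<^sub>2 \<cdot> c = b)"
      by (rule ex_weak_pullback[OF m(1) m(1)])
    then show thesis using that m_iff by blast
  qed

  \<comment> \<open>In the square to which \<open>kp\<close> is applied,
    \<open>k\<^sub>2 : K \<rightarrow> R\<close> lies over \<open>h : X \<rightarrow> Y\<close>,
    with the split epimorphisms \<open>f\<close> and \<open>g\<close> as the other two sides. The
    section \<open>t\<close> sends \<open>y\<close> to the loop of \<open>R\<close> at the chosen
    preimage \<open>k \<cdot> y\<close>, a loop being a value of \<open>\<delta>\<close>.\<close>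
  define f where "f = r\<^sub>1 \<cdot> k\<^sub>1"
  define g where "g = h \<cdot> r\<^sub>1"
  define t where "t = \<delta> \<cdot> k"
  have f: "f \<in> Hom A K X" unfolding f_def using cmp_hom[OF K(2) r(1)] .
  have g: "g \<in> Hom A R Y" unfolding g_def using hr(1) .
  have t: "t \<in> Hom A Y R" unfolding t_def using cmp_hom[OF k(1) \<delta>(1)] .
  have kh: "k \<cdot> h \<in> Hom A X X" using cmp_hom[OF h(1) k(1)] .
  have \<delta>kh: "\<delta> \<cdot> (k \<cdot> h) \<in> Hom A X R" using cmp_hom[OF kh \<delta>(1)] .
  have hkh: "h \<cdot> (k \<cdot> h) = h" using cmp_eq_extend1[OF k(2,1) h(1) h(1)] ide_left[OF h(1)] by simp
  \<comment> \<open>Compatibility of the sections prescribes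
    \<open>k\<^sub>2 \<cdot> s = t \<cdot> h\<close>, the loop at
    \<open>k \<cdot> (h \<cdot> x)\<close>, whereas \<open>f \<cdot> s\<close> must be the identity,
    so the first component is taken to be the loop at \<open>x\<close>. The two loops form an
    element of \<open>K\<close> since \<open>h \<cdot> (k \<cdot> h) = h\<close>.\<close>
  have "h \<cdot> (r\<^sub>1 \<cdot> \<delta>) = h \<cdot> (r\<^sub>1 \<cdot> (\<delta> \<cdot> (k \<cdot> h)))" "h \<cdot> (r\<^sub>2 \<cdot> \<delta>) = h \<cdot> (r\<^sub>2 \<cdot> (\<delta> \<cdot> (k \<cdot> h)))"
    unfolding \<delta>_cancel[OF kh] hkh \<delta>(2,3) using ide_right[OF h(1)] by auto
  then obtain s where s: "s \<in> Hom A X K" "k\<^sub>1 \<cdot> s = \<delta>" "k\<^sub>2 \<cdot> s = \<delta> \<cdot> (k \<cdot> h)"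
    using K_lift[OF ob(1) \<delta>(1) \<delta>kh] by blast
  obtain d where d: "d \<in> Hom A R K" "k\<^sub>2 \<cdot> d = Ide A R" using K_lift[OF ob(2) id(3) id(3)] by blast
  have k2: "regular_epi A k\<^sub>2" using split_epi_regular[OF K(3) d] .
  have fs: "f \<cdot> s = Ide A X" unfolding f_def using assoc[OF s(1) K(2) r(1)] s(2) \<delta>(2) by simp
  have gt: "g \<cdot> t = Ide A Y"
    unfolding g_def t_def using assoc[OF t[unfolded t_def] r(1) h(1)] \<delta>_cancel(1)[OF k(1)] k(2) by simp
  have gk: "g \<cdot> k\<^sub>2 = h \<cdot> f" unfolding g_def f_def using assoc[OF K(3) r(1) h(1)] K(4) by simp
  have ks: "k\<^sub>2 \<cdot> s = t \<cdot> h" unfolding t_def using s(3) assoc[OF h(1) k(1) \<delta>(1)] by simp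
  obtain F \<beta>\<^sub>1 \<beta>\<^sub>2 where F: "F \<in> Ob C" "\<beta>\<^sub>1 \<in> Hom A F K" "\<beta>\<^sub>2 \<in> Hom A F K" "f \<cdot> \<beta>\<^sub>1 = f \<cdot> \<beta>\<^sub>2"
    "\<forall>Z\<in>Ob C. \<forall>a\<in>Hom A Z K. \<forall>b\<in>Hom A Z K. f \<cdot> a = f \<cdot> b \<longrightarrow> (\<exists>c\<in>Hom A Z F. \<beta>\<^sub>1 \<cdot> c = a \<and> \<beta>\<^sub>2 \<cdot> c = b)"
    by (rule ex_weak_pullback[OF f f])
  have "weak_kernel_pair C f F \<beta>\<^sub>1 \<beta>\<^sub>2"
    unfolding weak_kernel_pair_def weak_pullback_iff[OF K(1,1) ob(1) F(1) f f F(2,3)] using F(4,5) by blast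
  then have "weak_kernel_pair C g F (k\<^sub>2 \<cdot> \<beta>\<^sub>1) (k\<^sub>2 \<cdot> \<beta>\<^sub>2)"
    using kp[OF K(1) ob(2,1,3) F(1) K(3) k2 h f s(1) g t F(2,3) fs gt gk ks] by blast
  then have G_pts: "points A P (k\<^sub>2 \<cdot> \<beta>\<^sub>1, k\<^sub>2 \<cdot> \<beta>\<^sub>2) = {(a, b) \<in> Hom A P R \<times> Hom A P R. g \<cdot> a = g \<cdot> b}"
    using weak_kernel_pair_iff[OF ob(2,3) F(1) g cmp_hom[OF F(2) K(3)] cmp_hom[OF F(3) K(3)]] P by blast

  \<comment> \<open>Symmetry turns the first pair round, so both pairs start at \<open>v\<close>,
    and the elements \<open>a\<close> and \<open>b\<close> representing them satisfy
    \<open>g \<cdot> a = g \<cdot> b\<close>.\<close>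
  obtain v where "(u, v) \<in> points A P (h \<cdot> r\<^sub>1, h \<cdot> r\<^sub>2)" and vw: "(v, w) \<in> points A P (h \<cdot> r\<^sub>1, h \<cdot> r\<^sub>2)"
    using uw by blast
  then have "(v, u) \<in> points A P (h \<cdot> r\<^sub>1, h \<cdot> r\<^sub>2)"
    using E[OF P] unfolding points_cmp_iff[OF r h(1)] equivalence_on_def by blast
  then obtain a where a: "a \<in> Hom A P R" "v = (h \<cdot> r\<^sub>1) \<cdot> a" "u = (h \<cdot> r\<^sub>2) \<cdot> a" using points_iff[OF hr(1)] by blast
  obtain b where b: "b \<in> Hom A P R" "v = (h \<cdot> r\<^sub>1) \<cdot> b" "w = (h \<cdot> r\<^sub>2) \<cdot> b" using vw points_iff[OF hr(1)] by blast
  have "(a, b) \<in> points A P (k\<^sub>2 \<cdot> \<beta>\<^sub>1, k\<^sub>2 \<cdot> \<beta>\<^sub>2)" unfolding G_pts g_def using a b by simp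
  then obtain c where c: "c \<in> Hom A P F" "a = (k\<^sub>2 \<cdot> \<beta>\<^sub>1) \<cdot> c" "b = (k\<^sub>2 \<cdot> \<beta>\<^sub>2) \<cdot> c"
    using points_iff[OF cmp_hom[OF F(2) K(3)]] by blast
  define a' where "a' = \<beta>\<^sub>1 \<cdot> c"
  define b' where "b' = \<beta>\<^sub>2 \<cdot> c"
  have ab': "a' \<in> Hom A P K" "b' \<in> Hom A P K" "a = k\<^sub>2 \<cdot> a'" "b = k\<^sub>2 \<cdot> b'" "f \<cdot> a' = f \<cdot> b'"
    unfolding a'_def b'_def using cmp_hom[OF c(1) F(2)] cmp_hom[OF c(1) F(3)] c(2,3)
      assoc[OF c(1) F(2) K(3)] assoc[OF c(1) F(3) K(3)] cmp_eq_extend[OF F(4,2) f F(3) f c(1)] by auto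
  \<comment> \<open>By \<open>f \<cdot> a' = f \<cdot> b'\<close>, the elements
    \<open>k\<^sub>1 \<cdot> a'\<close> and \<open>k\<^sub>1 \<cdot> b'\<close> of \<open>R\<close>
    have the same source in \<open>X\<close>, so their targets \<open>x\<close> and \<open>y\<close>
    are related by \<open>R\<close>. As both targets are preserved under \<open>h\<close> on passing
    from \<open>k\<^sub>1\<close> to \<open>k\<^sub>2\<close>, their images are \<open>u\<close> and
    \<open>w\<close>.\<close>
  define x where "x = r\<^sub>2 \<cdot> (k\<^sub>1 \<cdot> a')"
  define y where "y = r\<^sub>2 \<cdot> (k\<^sub>1 \<cdot> b')"
  have kab: "k\<^sub>1 \<cdot> a' \<in> Hom A P R" "k\<^sub>1 \<cdot> b' \<in> Hom A P R" using ab' cmp_hom[OF _ K(2)] by auto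
  have "r\<^sub>1 \<cdot> (k\<^sub>1 \<cdot> a') = r\<^sub>1 \<cdot> (k\<^sub>1 \<cdot> b')"
    using ab'(5) assoc[OF ab'(1) K(2) r(1)] assoc[OF ab'(2) K(2) r(1)] unfolding f_def by simp
  then have "(r\<^sub>1 \<cdot> (k\<^sub>1 \<cdot> a'), x) \<in> points A P (r\<^sub>1, r\<^sub>2)" "(r\<^sub>1 \<cdot> (k\<^sub>1 \<cdot> a'), y) \<in> points A P (r\<^sub>1, r\<^sub>2)"
    unfolding x_def y_def points_iff[OF r(1)] using kab by metis+
  then have "(x, y) \<in> points A P (r\<^sub>1, r\<^sub>2)" using E[OF P] unfolding equivalence_on_def by blast
  moreover have h_r2: "h \<cdot> (r\<^sub>2 \<cdot> (k\<^sub>1 \<cdot> z)) = (h \<cdot> r\<^sub>2) \<cdot> (k\<^sub>2 \<cdot> z)" if z: "z \<in> Hom A P K" for z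
    using cmp_eq_extend[OF K(5) cmp_hom[OF K(2) r(2)] h(1) cmp_hom[OF K(3) r(2)] h(1) z]
      assoc[OF z K(2) r(2)] assoc[OF z K(3) r(2)] assoc[OF cmp_hom[OF z K(3)] r(2) h(1)] by simp
  moreover have "u = h \<cdot> x" "w = h \<cdot> y"
    unfolding x_def y_def h_r2[OF ab'(1)] h_r2[OF ab'(2)] using a b ab' by auto
  ultimately show "(u, w) \<in> points A P (h \<cdot> r\<^sub>1, h \<cdot> r\<^sub>2)" using points_cmp_iff[OF r h(1)] by blast
qed

end

theorem proposition4p6:
  fixes A C :: "('o, 'm) cat"
  assumes "regular_category A" and "projective_cover C A"
  shows "(goursat A \<longleftrightarrow> weak_goursat C A) \<and>
    (weak_goursat C A \<longleftrightarrow>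
      (\<forall>X U Y W F G \<alpha> \<beta> f s g t \<beta>\<^sub>1 \<beta>\<^sub>2 \<rho>\<^sub>1 \<rho>\<^sub>2 l.
        \<alpha> \<in> Hom C X U \<and> \<beta> \<in> Hom C Y W \<and>
        f \<in> Hom C X Y \<and> s \<in> Hom C Y X \<and> g \<in> Hom C U W \<and> t \<in> Hom C W U \<and>
        \<beta>\<^sub>1 \<in> Hom C F X \<and> \<beta>\<^sub>2 \<in> Hom C F X \<and> \<rho>\<^sub>1 \<in> Hom C G U \<and> \<rho>\<^sub>2 \<in> Hom C G U \<and>
        l \<in> Hom C F G \<and>
        cover_regular_epi C A \<alpha> \<and> cover_regular_epi C A \<beta> \<and> cover_regular_epi C A l \<and>
        f \<cdot>\<^bsub>C\<^esub> s = Ide C Y \<and> g \<cdot>\<^bsub>C\<^esub> t = Ide C W \<and>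
        g \<cdot>\<^bsub>C\<^esub> \<alpha> = \<beta> \<cdot>\<^bsub>C\<^esub> f \<and> \<alpha> \<cdot>\<^bsub>C\<^esub> s = t \<cdot>\<^bsub>C\<^esub> \<beta> \<and>
        \<alpha> \<cdot>\<^bsub>C\<^esub> \<beta>\<^sub>1 = \<rho>\<^sub>1 \<cdot>\<^bsub>C\<^esub> l \<and> \<alpha> \<cdot>\<^bsub>C\<^esub> \<beta>\<^sub>2 = \<rho>\<^sub>2 \<cdot>\<^bsub>C\<^esub> l \<and>
        weak_kernel_pair C f F \<beta>\<^sub>1 \<beta>\<^sub>2 \<longrightarrow>
        weak_kernel_pair C g G \<rho>\<^sub>1 \<rho>\<^sub>2))"
    (is "_ \<and> (_ \<longleftrightarrow> ?iii)")
proof -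
  interpret projective_covering A C
    using assms unfolding projective_covering_def projective_covering_axioms_def regular_category_def by simp
  have "?iii" if wg: "weak_goursat C A"
  proof (intro allI impI, elim conjE)
    fix X U Y W F G \<alpha> \<beta> f s g t \<beta>\<^sub>1 \<beta>\<^sub>2 \<rho>\<^sub>1 \<rho>\<^sub>2 l
    assume hC: "\<alpha> \<in> Hom C X U" "\<beta> \<in> Hom C Y W" "f \<in> Hom C X Y" "s \<in> Hom C Y X" "g \<in> Hom C U W"
        "t \<in> Hom C W U" "\<beta>\<^sub>1 \<in> Hom C F X" "\<beta>\<^sub>2 \<in> Hom C F X" "\<rho>\<^sub>1 \<in> Hom C G U" "\<rho>\<^sub>2 \<in> Hom C G U" "l \<in> Hom C F G"
      and re: "cover_regular_epi C A \<alpha>" "cover_regular_epi C A l"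
      and eqs: "f \<cdot>\<^bsub>C\<^esub> s = Ide C Y" "g \<cdot>\<^bsub>C\<^esub> \<alpha> = \<beta> \<cdot>\<^bsub>C\<^esub> f" "\<alpha> \<cdot>\<^bsub>C\<^esub> s = t \<cdot>\<^bsub>C\<^esub> \<beta>"
        "\<alpha> \<cdot>\<^bsub>C\<^esub> \<beta>\<^sub>1 = \<rho>\<^sub>1 \<cdot>\<^bsub>C\<^esub> l" "\<alpha> \<cdot>\<^bsub>C\<^esub> \<beta>\<^sub>2 = \<rho>\<^sub>2 \<cdot>\<^bsub>C\<^esub> l"
      and wk: "weak_kernel_pair C f F \<beta>\<^sub>1 \<beta>\<^sub>2"
    have h: "X \<in> Ob C" "U \<in> Ob C" "Y \<in> Ob C" "W \<in> Ob C" "F \<in> Ob C" "G \<in> Ob C"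
        "\<alpha> \<in> Hom A X U" "\<beta> \<in> Hom A Y W" "f \<in> Hom A X Y" "s \<in> Hom A Y X" "g \<in> Hom A U W"
        "t \<in> Hom A W U" "\<beta>\<^sub>1 \<in> Hom A F X" "\<beta>\<^sub>2 \<in> Hom A F X" "\<rho>\<^sub>1 \<in> Hom A G U" "\<rho>\<^sub>2 \<in> Hom A G U" "l \<in> Hom A F G"
      using hC Hom_C_iff by auto
    have re': "regular_epi A \<alpha>" "regular_epi A l" using re unfolding cover_regular_epi_def by auto
    note eqs' = eqs[unfolded Ide_C[OF h(3)] cmp_C[OF hC(4,3)] cmp_C[OF hC(1,5)] cmp_C[OF hC(3,2)]
      cmp_C[OF hC(4,1)] cmp_C[OF hC(2,6)] cmp_C[OF hC(7,1)] cmp_C[OF hC(11,9)] cmp_C[OF hC(8,1)] cmp_C[OF hC(11,10)]]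
    show "weak_kernel_pair C g G \<rho>\<^sub>1 \<rho>\<^sub>2"
      by (rule weak_goursat_imp_weak_kernel_pair[OF wg h(1-7) re'(1) h(8-17) re'(2) eqs' wk])
  qed
  moreover have "weak_goursat C A" if iii: ?iii
  proof (rule weak_kernel_pair_imp_weak_goursat)
    fix X U Y W F \<alpha> \<beta> f s g t \<beta>\<^sub>1 \<beta>\<^sub>2
    assume ob: "X \<in> Ob C" "U \<in> Ob C" "Y \<in> Ob C" "W \<in> Ob C" "F \<in> Ob C"
      and h: "\<alpha> \<in> Hom A X U" "\<beta> \<in> Hom A Y W" "f \<in> Hom A X Y" "s \<in> Hom A Y X" "g \<in> Hom A U W"
        "t \<in> Hom A W U" "\<beta>\<^sub>1 \<in> Hom A F X" "\<beta>\<^sub>2 \<in> Hom A F X"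
      and re: "regular_epi A \<alpha>" "regular_epi A \<beta>"
      and eqs: "f \<cdot>\<^bsub>A\<^esub> s = Ide A Y" "g \<cdot>\<^bsub>A\<^esub> t = Ide A W" "g \<cdot>\<^bsub>A\<^esub> \<alpha> = \<beta> \<cdot>\<^bsub>A\<^esub> f" "\<alpha> \<cdot>\<^bsub>A\<^esub> s = t \<cdot>\<^bsub>A\<^esub> \<beta>"
      and wk: "weak_kernel_pair C f F \<beta>\<^sub>1 \<beta>\<^sub>2"
    \<comment> \<open>Condition (iii) is applied with \<open>G = F\<close> and the identity of
      \<open>F\<close> as \<open>l\<close>, which is split and hence a regular epimorphism;
      \<open>\<rho>\<^sub>1, \<rho>\<^sub>2\<close> then become the composites of
      \<open>\<alpha>\<close> with \<open>\<beta>\<^sub>1, \<beta>\<^sub>2\<close>.\<close>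
    have iF: "Ide A F \<in> Hom A F F" using ob(5) Ob_C ide_hom by blast
    have \<rho>: "\<alpha> \<cdot>\<^bsub>A\<^esub> \<beta>\<^sub>1 \<in> Hom A F U" "\<alpha> \<cdot>\<^bsub>A\<^esub> \<beta>\<^sub>2 \<in> Hom A F U" using cmp_hom h by blast+
    have "regular_epi A (Ide A F)" using split_epi_regular[OF iF iF ide_left[OF iF]] .
    moreover have hC: "\<alpha> \<in> Hom C X U" "\<beta> \<in> Hom C Y W" "f \<in> Hom C X Y" "s \<in> Hom C Y X" "g \<in> Hom C U W"
        "t \<in> Hom C W U" "\<beta>\<^sub>1 \<in> Hom C F X" "\<beta>\<^sub>2 \<in> Hom C F X" "\<alpha> \<cdot>\<^bsub>A\<^esub> \<beta>\<^sub>1 \<in> Hom C F U" "\<alpha> \<cdot>\<^bsub>A\<^esub> \<beta>\<^sub>2 \<in> Hom C F U"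
        "Ide A F \<in> Hom C F F"
      using h ob \<rho> iF Hom_C_iff by auto
    ultimately have re': "cover_regular_epi C A \<alpha>" "cover_regular_epi C A \<beta>" "cover_regular_epi C A (Ide A F)"
      using re unfolding cover_regular_epi_def by (auto simp: Hom_def)
    have eqs': "f \<cdot>\<^bsub>C\<^esub> s = Ide C Y" "g \<cdot>\<^bsub>C\<^esub> t = Ide C W" "g \<cdot>\<^bsub>C\<^esub> \<alpha> = \<beta> \<cdot>\<^bsub>C\<^esub> f" "\<alpha> \<cdot>\<^bsub>C\<^esub> s = t \<cdot>\<^bsub>C\<^esub> \<beta>"
        "\<alpha> \<cdot>\<^bsub>C\<^esub> \<beta>\<^sub>1 = (\<alpha> \<cdot>\<^bsub>A\<^esub> \<beta>\<^sub>1) \<cdot>\<^bsub>C\<^esub> Ide A F" "\<alpha> \<cdot>\<^bsub>C\<^esub> \<beta>\<^sub>2 = (\<alpha> \<cdot>\<^bsub>A\<^esub> \<beta>\<^sub>2) \<cdot>\<^bsub>C\<^esub> Ide A F"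
      unfolding Ide_C[OF ob(3)] Ide_C[OF ob(4)] cmp_C[OF hC(4,3)] cmp_C[OF hC(6,5)] cmp_C[OF hC(1,5)]
        cmp_C[OF hC(3,2)] cmp_C[OF hC(4,1)] cmp_C[OF hC(2,6)] cmp_C[OF hC(7,1)] cmp_C[OF hC(8,1)]
        cmp_C[OF hC(11,9)] cmp_C[OF hC(11,10)] ide_right[OF \<rho>(1)] ide_right[OF \<rho>(2)]
      using eqs by auto
    show "weak_kernel_pair C g F (\<alpha> \<cdot>\<^bsub>A\<^esub> \<beta>\<^sub>1) (\<alpha> \<cdot>\<^bsub>A\<^esub> \<beta>\<^sub>2)"
      using iii hC re' eqs' wk by blast
  qed
  ultimately show ?thesis using goursat_imp_weak_goursat weak_goursat_imp_goursat by blast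
qed

end
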